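(* Let $r>1$. Let $\mathcal N:\widetilde{\mathcal{WS}}_r\to\mathbb R$ be contained in the closure, with respect to uniform convergence, of $$\mathrm{span}\,\{t((F,\boldsymbol d),\cdot)\;:\;F\text{ multigraph},\ \boldsymbol d\in\mathbb N_0^{v(F)}\}\subseteq C_b(\widetilde{\mathcal{WS}}_r,\delta_1).$$ Then, for any $(W,f)\in\mathcal{WS}_r$ and random graph-signals $(G_n,\boldsymbol f_n)\sim\mathbb G_n(W,f)$, $(G_m,\boldsymbol f_m)\sim\mathbb G_m(W,f)$ on a common probability space, $$\mathbb E\,\big|\mathcal N(G_n,\boldsymbol f_n)-\mathcal N(G_m,\boldsymbol f_m)\big|\to0,\qquad n,m\to\infty.$$
   Context: $\mathcal{WS}_r$ is the set of graphon-signals $(W,f)$: $W:[0,1]^2\to[0,1]$ symmetric measurable, $f\in L^\infty[0,1]$ with $\|f\|_\infty\le r$. Let $S_{[0,1]}$ be the set of Lebesgue-measure preserving maps $\varphi:[0,1]\to[0,1]$ that are bijective almost everywhere; $W^\varphi(x,y)=W(\varphi(x),\varphi(y))$, $f^\varphi(x)=f(\varphi(x))$. $\delta_1((W,f),(V,g))=\inf_{\varphi\in S_{[0,1]}}\left(\|W-V^\varphi\|_1+\|f-g^\varphi\|_1\right)$. $\delta_\square$ is defined likewise from the cut norms $\|W\|_\square=\sup_{S,T}|\int_{S\times T}W\,d\lambda^2|$, $\|f\|_\square=\sup_S|\int_Sf\,d\lambda|$ ($S,T\subseteq[0,1]$ measurable). $\widetilde{\mathcal{WS}}_r$ is the quotient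 of $\mathcal{WS}_r$ identifying graphon-signals at $\delta_\square$-distance $0$ (equivalently $\delta_1$-distance $0$). $C_b(\widetilde{\mathcal{WS}}_r,\delta_1)$ is the space of bounded $\delta_1$-continuous real functions. In a multigraph the edges form a finite multiset of two-element subsets of the (finite) vertex set. For $V(F)=[k]$, $\boldsymbol d\in\mathbb N_0^k$, $t((F,\boldsymbol d),(W,f))=\int_{[0,1]^k}\big(\prod_{i\in V(F)}f(x_i)^{d_i}\big)\big(\prod_{\{i,j\}\in E(F)}W(x_i,x_j)\big)d\lambda^k(\boldsymbol x)$, factors repeated according to edge multiplicity. $\mathbb G_n(W,f)$: draw $X_1,\dots,X_n$ i.i.d. uniform on $[0,1]$; conditionally on these, let $G_n$ be the random simple graph on $[n]$ in which edge $\{i,j\}$ is present independently with probability $W(X_i,X_j)$, and let $\boldsymbol f_n=(f(X_1),\dots,f(X_n))$. A graph-signal $(G,\boldsymbol f)$ on $[n]$ with adjacency matrix $A$ is identified with its step graphon-signal $\big(\sum_{i,j}A_{ij}\mathbb 1_{I_i\times I_j},\sum_i f_i\mathbb 1_{I_i}\big)$, where $I_1,\dots,I_n$ is the partition of $[0,1]$ into consecutive intervals of length $1/n$. *)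

theory Defs
  imports "HOL-Probability.Probability"
begin

section \<open>Graphon-signals\<close>

text \<open>
  A graphon-signal \<open>(W, f)\<close> is given by representing functions \<open>real \<times> real \<Rightarrow> real\<close> and
  \<open>real \<Rightarrow> real\<close>, of which only the values on \<open>[0,1]\<^sup>2\<close> and \<open>[0,1]\<close> matter. Measurability is
  Borel measurability: every Lebesgue measurable function agrees almost everywhere with a Borel
  one, and all notions below are insensitive to changes on null sets.
\<close>

type_synonym graphon_signal = "(real \<times> real \<Rightarrow> real) \<times> (real \<Rightarrow> real)"

definition unit_measure :: "real measure" where
  "unit_measure = restrict_space lborel {0..1}"

definition graphon_signals :: "real \<Rightarrow> graphon_signal set" where
  "graphon_signals r =
    {(W, f). W \<in> borel_measurable (unit_measure \<Otimes>\<^sub>M unit_measure) \<and>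
       (\<forall>x\<in>{0..1}. \<forall>y\<in>{0..1}. W (x, y) \<in> {0..1} \<and> W (x, y) = W (y, x)) \<and>
       f \<in> borel_measurable unit_measure \<and> (AE x in unit_measure. \<bar>f x\<bar> \<le> r)}"

section \<open>Cut distance and the quotient space\<close>

definition cut_norm_graphon :: "(real \<times> real \<Rightarrow> real) \<Rightarrow> real" where
  "cut_norm_graphon U =
    (SUP (S, T) \<in> sets unit_measure \<times> sets unit_measure.
       \<bar>LINT p:S \<times> T|unit_measure \<Otimes>\<^sub>M unit_measure. U p\<bar>)"

definition cut_norm_signal :: "(real \<Rightarrow> real) \<Rightarrow> real" where
  "cut_norm_signal h = (SUP S \<in> sets unit_measure. \<bar>LINT x:S|unit_measure. h x\<bar>)"

text \<open>Measure preserving maps of \<open>[0,1]\<close> that are bijections between sets of full measure.\<close>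

definition mp_bijections :: "(real \<Rightarrow> real) set" where
  "mp_bijections =
    {\<phi>. \<phi> \<in> measurable unit_measure unit_measure \<and>
        distr unit_measure unit_measure \<phi> = unit_measure \<and>
        (\<exists>A\<in>sets unit_measure. \<exists>B\<in>sets unit_measure.
           emeasure unit_measure A = 1 \<and> emeasure unit_measure B = 1 \<and> bij_betw \<phi> A B)}"

definition cut_distance :: "graphon_signal \<Rightarrow> graphon_signal \<Rightarrow> real" where
  "cut_distance = (\<lambda>(W, f) (V, g). INF \<phi> \<in> mp_bijections.
     cut_norm_graphon (\<lambda>(x, y). W (x, y) - V (\<phi> x, \<phi> y)) +
     cut_norm_signal (\<lambda>x. f x - g (\<phi> x)))"

definition cut_equiv :: "real \<Rightarrow> (graphon_signal \<times> graphon_signal) set" where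
  "cut_equiv r =
    {(x, y). x \<in> graphon_signals r \<and> y \<in> graphon_signals r \<and> cut_distance x y = 0}"

text \<open>
  The quotient space is \<open>graphon_signals r // cut_equiv r\<close>, and \<open>gs_class r\<close> is the canonical
  projection to it. A function on the quotient is identified with its composition with
  \<open>gs_class r\<close>, a function on \<open>graphon_signals r\<close>.
\<close>

definition gs_class :: "real \<Rightarrow> graphon_signal \<Rightarrow> graphon_signal set" where
  "gs_class r x = cut_equiv r `` {x}"

section \<open>Homomorphism densities of decorated multigraphs\<close>

text \<open>Vertex sets are \<open>{..<k}\<close>; \<open>pairs k\<close> is the set of its two-element subsets.\<close>

definition pairs :: "nat \<Rightarrow> nat set set" where
  "pairs k = {e. e \<subseteq> {..<k} \<and> card e = 2}"

text \<open>
  The value \<open>W (x\<^sub>i, x\<^sub>j)\<close> for \<open>e = {i, j}\<close>; by symmetry of \<open>W\<close> the order of the endpoints is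
  irrelevant.
\<close>

definition edge_value :: "(real \<times> real \<Rightarrow> real) \<Rightarrow> (nat \<Rightarrow> real) \<Rightarrow> nat set \<Rightarrow> real" where
  "edge_value W x e = W (x (Min e), x (Max e))"

definition hom_density ::
  "nat \<Rightarrow> nat set multiset \<Rightarrow> (nat \<Rightarrow> nat) \<Rightarrow> graphon_signal \<Rightarrow> real" where
  "hom_density k E d = (\<lambda>(W, f).
     \<integral>x. (\<Prod>i<k. f (x i) ^ d i) * (\<Prod>e\<in>#E. edge_value W x e) \<partial>PiM {..<k} (\<lambda>_. unit_measure))"

text \<open>
  The homomorphism densities are bounded on \<open>graphon_signals r\<close> and descend to functions on the
  quotient that are continuous for the distance \<open>\<delta>\<^sub>1\<close>. Since these properties pass to linear
  combinations and uniform limits, the uniform closure of their span is the same whether it is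
  taken among all real functions or among the bounded continuous functions on the quotient.
\<close>

definition hom_densities :: "(graphon_signal \<Rightarrow> real) set" where
  "hom_densities = {hom_density k E d |k E d. set_mset E \<subseteq> pairs k}"

definition linear_span :: "('a \<Rightarrow> real) set \<Rightarrow> ('a \<Rightarrow> real) set" where
  "linear_span S = {\<lambda>x. \<Sum>i<l. c i * h i x |l (c :: nat \<Rightarrow> real) h. \<forall>i<l. h i \<in> S}"

definition uniform_closure :: "'a set \<Rightarrow> ('a \<Rightarrow> real) set \<Rightarrow> ('a \<Rightarrow> real) set" where
  "uniform_closure A S = {g. \<exists>P. (\<forall>j. P j \<in> S) \<and> uniform_limit A P g sequentially}"

section \<open>Graph-signals and sampling\<close>

text \<open>A graph-signal on \<open>{..<n}\<close> is given by the edge set of a simple graph and the signal values.\<close>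

type_synonym graph_signal = "nat set set \<times> (nat \<Rightarrow> real)"

definition graph_signal_space :: "nat \<Rightarrow> graph_signal measure" where
  "graph_signal_space n = count_space (Pow (pairs n)) \<Otimes>\<^sub>M PiM {..<n} (\<lambda>_. borel)"

text \<open>The half-open interval \<open>[i/n, (i+1)/n)\<close>, with \<open>1\<close> added to the last one.\<close>

definition interval_part :: "nat \<Rightarrow> nat \<Rightarrow> real set" where
  "interval_part n i =
    (if Suc i = n then {real i / real n..1} else {real i / real n..<real (Suc i) / real n})"

definition step_graphon_signal :: "nat \<Rightarrow> graph_signal \<Rightarrow> graphon_signal" where
  "step_graphon_signal n = (\<lambda>(G, v).
    (\<lambda>p. \<Sum>i<n. \<Sum>j<n. of_bool ({i, j} \<in> G) * indicator (interval_part n i \<times> interval_part n j) p,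
     \<lambda>x. \<Sum>i<n. v i * indicator (interval_part n i) x))"

definition independent_edges :: "nat \<Rightarrow> (nat set \<Rightarrow> real) \<Rightarrow> nat set set pmf" where
  "independent_edges n p =
    map_pmf (\<lambda>b. {e \<in> pairs n. b e}) (Pi_pmf (pairs n) False (\<lambda>e. bernoulli_pmf (p e)))"

text \<open>
  The conditional distribution of the random graph-signal given that the sample points are
  \<open>x\<close>. The restriction to \<open>Pow (pairs n)\<close>, an almost sure event, only matches the underlying
  space of \<open>measure_pmf\<close>, which is \<open>UNIV\<close>, with that of \<open>graph_signal_space n\<close>.
\<close>

definition sample_kernel :: "nat \<Rightarrow> graphon_signal \<Rightarrow> (nat \<Rightarrow> real) \<Rightarrow> graph_signal measure" where
  "sample_kernel n = (\<lambda>(W, f) x.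
     distr (restrict_space (measure_pmf (independent_edges n (edge_value W x))) (Pow (pairs n)))
       (graph_signal_space n) (\<lambda>G. (G, \<lambda>i\<in>{..<n}. f (x i))))"

definition sample_law :: "nat \<Rightarrow> graphon_signal \<Rightarrow> graph_signal measure" where
  "sample_law n Wf = PiM {..<n} (\<lambda>_. unit_measure) \<bind> sample_kernel n Wf"

section \<open>The sampling law and the quotient classes are well behaved\<close>

lemma finite_pairs [simp]: "finite (pairs n)"
  unfolding pairs_def by (rule finite_subset[of _ "Pow {..<n}"]) auto

lemma pairs_Min_Max:
  assumes "e \<in> pairs n" shows "Min e < n" "Max e < n"
proof -
  have "finite e" "e \<noteq> {}" "e \<subseteq> {..<n}"
    using assms by (auto simp: pairs_def intro: finite_subset)
  then show "Min e < n" "Max e < n" using Min_in[of e] Max_in[of e] by blast+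
qed

lemma space_unit_measure [simp]: "space unit_measure = {0..1}"
  by (simp add: unit_measure_def space_restrict_space)

lemma prob_space_unit_measure: "prob_space unit_measure"
  by (rule prob_spaceI) (simp add: unit_measure_def emeasure_restrict_space space_restrict_space)

lemma pmf_independent_edges:
  assumes "\<And>e. e \<in> pairs n \<Longrightarrow> p e \<in> {0..1}" and "G \<subseteq> pairs n"
  shows "pmf (independent_edges n p) G = (\<Prod>e\<in>pairs n. if e \<in> G then p e else 1 - p e)"
proof -
  let ?P = "Pi_pmf (pairs n) False (\<lambda>e. bernoulli_pmf (p e))"
  have "pmf (independent_edges n p) G = measure ?P ((\<lambda>b. {e \<in> pairs n. b e}) -` {G})"
    by (simp add: independent_edges_def pmf_map)
  also have "\<dots> = measure ?P {\<lambda>e. e \<in> G}"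
  proof (rule measure_pmf.finite_measure_eq_AE)
    show "AE b in ?P. (b \<in> (\<lambda>b. {e \<in> pairs n. b e}) -` {G}) = (b \<in> {\<lambda>e. e \<in> G})"
      using assms(2) set_Pi_pmf_subset[of "pairs n" False "\<lambda>e. bernoulli_pmf (p e)"]
      by (fastforce simp: AE_measure_pmf_iff fun_eq_iff)
  qed auto
  also have "\<dots> = pmf ?P (\<lambda>e. e \<in> G)" by (simp add: measure_pmf_single)
  also have "\<dots> = (\<Prod>e\<in>pairs n. pmf (bernoulli_pmf (p e)) (e \<in> G))"
    using assms(2) by (subst pmf_Pi') auto
  also have "\<dots> = (\<Prod>e\<in>pairs n. if e \<in> G then p e else 1 - p e)"
    by (rule prod.cong) (use assms(1) in auto)
  finally show ?thesis .
qed

lemma set_independent_edges: "set_pmf (independent_edges n p) \<subseteq> Pow (pairs n)"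
  by (auto simp: independent_edges_def)


lemma measurable_sample_kernel:
  assumes "(W, f) \<in> graphon_signals r"
  shows "sample_kernel n (W, f)
    \<in> PiM {..<n} (\<lambda>_. unit_measure) \<rightarrow>\<^sub>M prob_algebra (graph_signal_space n)"
proof (rule measurable_prob_algebraI)
  let ?P = "PiM {..<n} (\<lambda>_. unit_measure)"
  let ?v = "\<lambda>x. \<lambda>i\<in>{..<n}. f (x i)"
  let ?q = "\<lambda>x. independent_edges n (edge_value W x)"
  let ?R = "\<lambda>x. restrict_space (measure_pmf (?q x)) (Pow (pairs n))"
  have Wm [measurable]: "W \<in> borel_measurable (unit_measure \<Otimes>\<^sub>M unit_measure)"
    and fm [measurable]: "f \<in> borel_measurable unit_measure"
    and W01: "\<And>x y. x \<in> {0..1} \<Longrightarrow> y \<in> {0..1} \<Longrightarrow> W (x, y) \<in> {0..1}"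
    using assms unfolding graphon_signals_def by blast+
  have vm [measurable]: "?v \<in> ?P \<rightarrow>\<^sub>M PiM {..<n} (\<lambda>_. borel)"
    by (rule measurable_restrict) measurable
  have edge_m: "(\<lambda>x. edge_value W x e) \<in> borel_measurable ?P" if "e \<in> pairs n" for e
    unfolding edge_value_def
    by (measurable; use pairs_Min_Max[OF that] in simp)
  have edge01: "edge_value W x e \<in> {0..1}" if "e \<in> pairs n" "x \<in> space ?P" for e x
    using pairs_Min_Max[OF that(1)] that(2) unfolding edge_value_def
    by (intro W01) (auto simp: space_PiM PiE_iff)
  have sets_R: "sets (?R x) = sets (count_space (Pow (pairs n)))" for x
    by (auto simp: sets_restrict_space)
  have map: "(\<lambda>G. (G, ?v x)) \<in> ?R x \<rightarrow>\<^sub>M graph_signal_space n" if "x \<in> space ?P" for x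
    unfolding graph_signal_space_def measurable_cong_sets[OF sets_R refl]
    using measurable_space[OF vm that] by (simp add: space_pair_measure)
  have prob_R: "prob_space (?R x)" for x
  proof (rule prob_spaceI)
    have "emeasure (measure_pmf (?q x)) (Pow (pairs n)) = 1"
      using set_independent_edges[of n "edge_value W x"]
      by (intro measure_pmf.emeasure_eq_1_AE) (auto simp: AE_measure_pmf_iff)
    then show "emeasure (?R x) (space (?R x)) = 1"
      by (simp add: emeasure_restrict_space space_restrict_space)
  qed
  show prob: "prob_space (sample_kernel n (W, f) x)" if "x \<in> space ?P" for x
    unfolding sample_kernel_def prod.case
    by (rule prob_space.prob_space_distr[OF prob_R map[OF that]])
  show "sample_kernel n (W, f) \<in> ?P \<rightarrow>\<^sub>M subprob_algebra (graph_signal_space n)"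
  proof (rule measurable_subprob_algebra)
    show "subprob_space (sample_kernel n (W, f) x)" if "x \<in> space ?P" for x
      using prob[OF that] by (rule prob_space_imp_subprob_space)
    show "sets (sample_kernel n (W, f) x) = sets (graph_signal_space n)" for x
      by (simp add: sample_kernel_def)
    fix A assume A: "A \<in> sets (graph_signal_space n)"
    have "emeasure (sample_kernel n (W, f) x) A =
      (\<Sum>G\<in>Pow (pairs n). ennreal (\<Prod>e\<in>pairs n. if e \<in> G then edge_value W x e
         else 1 - edge_value W x e) * indicator A (G, ?v x))" if x: "x \<in> space ?P" for x
    proof -
      let ?B = "{G \<in> Pow (pairs n). (G, ?v x) \<in> A}"
      have "emeasure (sample_kernel n (W, f) x) A = emeasure (?R x) ?B"
        unfolding sample_kernel_def prod.case
        by (subst emeasure_distr[OF map[OF x] A])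
          (auto simp: space_restrict_space intro!: arg_cong[where f = "emeasure _"])
      also have "\<dots> = emeasure (measure_pmf (?q x)) ?B"
        by (rule emeasure_restrict_space) auto
      also have "\<dots> = (\<Sum>G\<in>?B. ennreal (pmf (?q x) G))"
        by (simp add: emeasure_measure_pmf_finite)
      also have "\<dots> = (\<Sum>G\<in>Pow (pairs n). ennreal (pmf (?q x) G) * indicator A (G, ?v x))"
        by (rule sum.mono_neutral_cong_left) (auto simp: indicator_def)
      also have "\<dots> = (\<Sum>G\<in>Pow (pairs n). ennreal (\<Prod>e\<in>pairs n. if e \<in> G then edge_value W x e
         else 1 - edge_value W x e) * indicator A (G, ?v x))"
        using edge01[OF _ x] by (intro sum.cong refl) (simp add: pmf_independent_edges)
      finally show ?thesis .
    qed
    moreover have "(\<lambda>x. \<Sum>G\<in>Pow (pairs n). ennreal (\<Prod>e\<in>pairs n. if e \<in> G then edge_value W x e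
         else 1 - edge_value W x e) * indicator A (G, ?v x)) \<in> borel_measurable ?P"
    proof (rule borel_measurable_sum)
      fix G assume G: "G \<in> Pow (pairs n)"
      have [measurable]: "(\<lambda>x. \<Prod>e\<in>pairs n. if e \<in> G then edge_value W x e else 1 - edge_value W x e)
        \<in> borel_measurable ?P"
        using edge_m by (intro borel_measurable_prod) auto
      have [measurable]: "(\<lambda>x. (G, ?v x)) \<in> ?P \<rightarrow>\<^sub>M graph_signal_space n"
        unfolding graph_signal_space_def
        by (intro measurable_Pair measurable_const vm) (use G in simp)
      note A [measurable]
      show "(\<lambda>x. ennreal (\<Prod>e\<in>pairs n. if e \<in> G then edge_value W x e
         else 1 - edge_value W x e) * indicator A (G, ?v x)) \<in> borel_measurable ?P"
        by measurable
    qed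
    ultimately show "(\<lambda>x. emeasure (sample_kernel n (W, f) x) A) \<in> borel_measurable ?P"
      using measurable_cong[of ?P] by (simp cong: measurable_cong)
  qed
qed

lemma prob_space_sample_law:
  assumes "(W, f) \<in> graphon_signals r"
  shows "prob_space (sample_law n (W, f))" "sets (sample_law n (W, f)) = sets (graph_signal_space n)"
proof -
  have P: "PiM {..<n} (\<lambda>_. unit_measure) \<in> space (prob_algebra (PiM {..<n} (\<lambda>_. unit_measure)))"
    by (simp add: space_prob_algebra prob_space_PiM prob_space_unit_measure)
  show "prob_space (sample_law n (W, f))" "sets (sample_law n (W, f)) = sets (graph_signal_space n)"
    unfolding sample_law_def
    using prob_space_bind'[OF P measurable_sample_kernel[OF assms]]
      sets_bind'[OF P measurable_sample_kernel[OF assms]] by auto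
qed


lemma id_mp_bijection: "(\<lambda>x. x) \<in> mp_bijections"
proof -
  have "{0..1} \<in> sets unit_measure" using sets.top[of unit_measure] by simp
  moreover have "emeasure unit_measure {0..1} = 1"
    using prob_space.emeasure_space_1[OF prob_space_unit_measure] by simp
  moreover have "bij_betw (\<lambda>x. x) {0..1} {0..1::real}" by (simp add: bij_betw_def)
  ultimately show ?thesis
    unfolding mp_bijections_def by (auto simp: distr_id)
qed

lemma set_integral_bound:
  fixes h :: "'a \<Rightarrow> real"
  assumes "integrable M h" "S \<in> sets M"
  shows "\<bar>LINT x:S|M. h x\<bar> \<le> (LINT x|M. \<bar>h x\<bar>)"
proof -
  have "\<bar>LINT x:S|M. h x\<bar> \<le> (LINT x|M. \<bar>indicator S x * h x\<bar>)"
    unfolding set_lebesgue_integral_def using integral_abs_bound by auto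
  also have "\<dots> \<le> (LINT x|M. \<bar>h x\<bar>)"
    using assms by (intro integral_mono integrable_abs integrable_mult_indicator[where 'b=real, simplified])
      (auto simp: indicator_def)
  finally show ?thesis .
qed

lemma cut_norm_nonneg:
  "integrable (unit_measure \<Otimes>\<^sub>M unit_measure) U \<Longrightarrow> 0 \<le> cut_norm_graphon U"
  "integrable unit_measure h \<Longrightarrow> 0 \<le> cut_norm_signal h"
proof -
  assume U: "integrable (unit_measure \<Otimes>\<^sub>M unit_measure) U"
  show "0 \<le> cut_norm_graphon U"
    unfolding cut_norm_graphon_def
    by (rule cSUP_upper2[where x = "({}, {})"])
       (auto intro!: bdd_aboveI2 set_integral_bound[OF U])
next
  assume h: "integrable unit_measure h"
  show "0 \<le> cut_norm_signal h"
    unfolding cut_norm_signal_def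
    by (rule cSUP_upper2[where x = "{}"])
       (auto intro!: bdd_aboveI2 set_integral_bound[OF h])
qed

lemma gs_class_self:
  assumes "x \<in> graphon_signals r" shows "x \<in> gs_class r x"
proof -
  obtain W f where x: "x = (W, f)" by fastforce
  interpret U: prob_space unit_measure by (rule prob_space_unit_measure)
  interpret U2: pair_prob_space unit_measure unit_measure ..
  have Wm [measurable]: "W \<in> borel_measurable (unit_measure \<Otimes>\<^sub>M unit_measure)"
    and fm [measurable]: "f \<in> borel_measurable unit_measure"
    and W01: "\<And>x y. x \<in> {0..1} \<Longrightarrow> y \<in> {0..1} \<Longrightarrow> W (x, y) \<in> {0..1}"
    and fr: "AE x in unit_measure. \<bar>f x\<bar> \<le> r"
    using assms unfolding graphon_signals_def x by blast+
  have Wi: "integrable (unit_measure \<Otimes>\<^sub>M unit_measure) W"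
    using W01 by (intro U2.P.integrable_const_bound[where B = 1]) (auto simp: space_pair_measure)
  have fi: "integrable unit_measure f"
    using fr by (intro U.integrable_const_bound[where B = r]) auto
  have nn: "0 \<le> cut_norm_graphon (\<lambda>(x, y). W (x, y) - W (\<phi> x, \<phi> y)) +
     cut_norm_signal (\<lambda>x. f x - f (\<phi> x))" if "\<phi> \<in> mp_bijections" for \<phi>
  proof -
    have [measurable]: "\<phi> \<in> unit_measure \<rightarrow>\<^sub>M unit_measure"
      and d: "distr unit_measure unit_measure \<phi> = unit_measure"
      using that by (auto simp: mp_bijections_def)
    have p: "\<phi> x \<in> {0..1}" if "x \<in> {0..1}" for x
      using measurable_space[of \<phi> unit_measure unit_measure x] that by simp
    have "integrable unit_measure (\<lambda>x. f (\<phi> x))"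
      by (rule integrable_distr[of _ _ unit_measure]) (simp_all add: d fi)
    moreover have "integrable (unit_measure \<Otimes>\<^sub>M unit_measure) (\<lambda>(x, y). W (\<phi> x, \<phi> y))"
      using W01 p by (intro U2.P.integrable_const_bound[where B = 1]) (auto simp: space_pair_measure)
    ultimately show ?thesis using Wi fi
      by (intro add_nonneg_nonneg cut_norm_nonneg)
         (auto simp: case_prod_unfold)
  qed
  have "cut_distance x x = 0"
    unfolding cut_distance_def x prod.case
  proof (rule antisym)
    have z: "cut_norm_graphon (\<lambda>(x, y). W (x, y) - W (x, y)) + cut_norm_signal (\<lambda>x. f x - f x) = 0"
    proof -
      have "sets unit_measure \<noteq> {}" using sets.empty_sets[of unit_measure] by blast
      then show ?thesis
      by (simp add: cut_norm_graphon_def cut_norm_signal_def case_prod_unfold set_lebesgue_integral_def)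
    qed
    show "(INF \<phi>\<in>mp_bijections. cut_norm_graphon (\<lambda>(x, y). W (x, y) - W (\<phi> x, \<phi> y)) +
       cut_norm_signal (\<lambda>x. f x - f (\<phi> x))) \<le> 0"
      by (rule cINF_lower2[OF _ id_mp_bijection]) (use nn z in \<open>auto intro!: bdd_belowI2\<close>)
    show "0 \<le> (INF \<phi>\<in>mp_bijections. cut_norm_graphon (\<lambda>(x, y). W (x, y) - W (\<phi> x, \<phi> y)) +
       cut_norm_signal (\<lambda>x. f x - f (\<phi> x)))"
      by (rule cINF_greatest) (use nn id_mp_bijection in auto)
  qed
  then show ?thesis using assms by (simp add: gs_class_def cut_equiv_def)
qed
end

theory Submission
  imports Defs
begin

text \<open>
  The density of a sampled graph-signal is an average over all maps \<open>\<phi>\<close> from the vertices of the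
  multigraph to the sample. For injective \<open>\<phi>\<close> the expected summand is the density in \<open>(W, f)\<close> of the
  underlying simple graph, since a 0/1-valued adjacency matrix does not see edge multiplicities;
  the other \<open>\<phi>\<close> are a vanishing fraction. So the means converge, and applying this to the disjoint
  union of two copies of the multigraph shows that the variances vanish. Sampled densities thus
  converge in \<open>L\<^sup>1\<close> to constants, and approximating \<open>\<N>\<close> uniformly by a linear combination of
  densities gives the theorem.
\<close>

subsection \<open>Densities of step graphon-signals\<close>

text \<open>The constant that a sampled density approaches is in general not the density of (W, f):
  for a double edge without signal powers it is the integral of W, not of W^2. The sampled values of
  \<N> thus need not approach \<N>(W, f), and the statement compares two samples instead. It
  suffices to find for every \<epsilon> some constant within \<epsilon> in mean of all large
  samples; this constant may vary with \<epsilon>, and no information on the joint law of the two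
  samples enters.

  An obstacle is the null set where |f| exceeds r. A sample that meets it leaves
  \<open>graphon_signals r\<close>, where uniform approximation says nothing. All estimates are
  therefore made for signals clipped to [-r, r], which almost surely changes nothing. Measurability
  of the unclipped quantity is settled separately: outside \<open>graphon_signals r\<close> every
  class is the empty set, so \<N> has a single value there.

  Second moments require no count of pairs of vertex maps. The square of a density is again a
  density, and forgetting multiplicities commutes with disjoint union, so the second moments
  converge to the square of the limit of the means.\<close>

lemma pairs_eq_Min_Max:
  assumes "e \<in> pairs k"
  shows "e = {Min e, Max e}" and "Min e < Max e"
proof -
  obtain a b where "e = {a, b}" "a \<noteq> b"
    using assms by (auto simp: pairs_def card_2_iff)
  then show "e = {Min e, Max e}" "Min e < Max e"
    by (auto simp: min_def max_def)
qed

lemma image_pairs: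
  assumes "e \<in> pairs k" "inj_on \<phi> {..<k}" "\<phi> \<in> {..<k} \<rightarrow> {..<n}"
  shows "\<phi> ` e \<in> pairs n"
proof -
  have e: "e \<subseteq> {..<k}" "card e = 2"
    using assms(1) by (auto simp: pairs_def)
  then have "card (\<phi> ` e) = 2"
    using card_image[OF inj_on_subset[OF assms(2) e(1)]] by simp
  then show ?thesis
    using e assms(3) by (auto simp: pairs_def)
qed

text \<open>0 and 1 are idempotent, so only the support of \<open>E\<close> survives on the right.
  This is the point where edge multiplicities are discarded.\<close>

lemma prod_mset_of_bool:
  "(\<Prod>e\<in>#E. of_bool (P e)) = (of_bool (\<forall>e\<in>#E. P e) :: real)"
  by (induction E) auto

text \<open>An explicit index gives existence and uniqueness of the interval around \<open>x\<close>
  at once. The \<open>min\<close> only acts at \<open>x = 1\<close>, where the floor is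
  \<open>n\<close> but the point belongs to the last interval.\<close>

lemma interval_part_iff:
  assumes "x \<in> {0..1}" "i < n"
  shows "x \<in> interval_part n i \<longleftrightarrow> i = min (n - 1) (nat \<lfloor>x * n\<rfloor>)"
proof -
  have n: "real n > 0" using assms(2) by simp
  have x: "0 \<le> x * n" "x * n \<le> n" using assms(1) n by auto
  show ?thesis
  proof (cases "Suc i = n")
    case True
    have "x \<in> interval_part n i \<longleftrightarrow> real i \<le> x * n"
      using True assms n by (auto simp: interval_part_def divide_simps)
    also have "\<dots> \<longleftrightarrow> i \<le> nat \<lfloor>x * n\<rfloor>"
      using x by (simp add: le_nat_iff le_floor_iff)
    finally show ?thesis using True by auto
  next
    case False
    have "x \<in> interval_part n i \<longleftrightarrow> real i \<le> x * n \<and> x * n < real (Suc i)"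
      using False n by (auto simp: interval_part_def divide_simps)
    also have "\<dots> \<longleftrightarrow> i = nat \<lfloor>x * n\<rfloor>"
      using x by (simp add: eq_nat_nat_iff nat_eq_iff2 eq_commute[of "int i"] floor_eq_iff)
        linarith
    also have "\<dots> \<longleftrightarrow> i = min (n - 1) (nat \<lfloor>x * n\<rfloor>)"
      using False assms(2) by arith
    finally show ?thesis .
  qed
qed

lemma interval_part_subset: "i < n \<Longrightarrow> interval_part n i \<subseteq> {0..1}"
proof
  fix x assume i: "i < n" and x: "x \<in> interval_part n i"
  then have "0 \<le> real i / real n" "real (Suc i) / real n \<le> 1" by (auto simp: divide_simps)
  moreover have "real i / real n \<le> x" "x < real (Suc i) / real n \<or> x \<le> 1"
    using x by (auto simp: interval_part_def split: if_splits)
  ultimately have "0 \<le> x" "x \<le> 1" by linarith+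
  then show "x \<in> {0..1}" by simp
qed

lemma sets_interval_part [measurable]: "i < n \<Longrightarrow> interval_part n i \<in> sets unit_measure"
  using interval_part_subset[of i n]
  by (auto simp: unit_measure_def sets_restrict_space_iff interval_part_def)

lemma measure_interval_part:
  assumes "i < n"
  shows "measure unit_measure (interval_part n i) = 1 / n"
proof -
  have "measure unit_measure (interval_part n i) = measure lborel (interval_part n i)"
    unfolding unit_measure_def using interval_part_subset[OF assms]
    by (intro measure_restrict_space) auto
  also have "\<dots> = 1 / n"
    using assms by (auto simp: interval_part_def divide_simps)
  finally show ?thesis .
qed

lemma step_graphon_signal_signal:
  assumes "x \<in> interval_part n i" "i < n"
  shows "snd (step_graphon_signal n (G, v)) x = v i"
proof -
  have x: "x \<in> {0..1}" using interval_part_subset[OF assms(2)] assms(1) by auto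
  have "(\<Sum>j<n. v j * indicator (interval_part n j) x) = (\<Sum>j<n. if j = i then v j else 0)"
    using interval_part_iff[OF x] assms by (intro sum.cong) (auto simp: indicator_def)
  then show ?thesis using assms(2) by (simp add: step_graphon_signal_def)
qed

lemma step_graphon_signal_graphon:
  assumes "x \<in> interval_part n i" "y \<in> interval_part n j" "i < n" "j < n"
  shows "fst (step_graphon_signal n (G, v)) (x, y) = of_bool ({i, j} \<in> G)"
proof -
  have x: "x \<in> {0..1}" and y: "y \<in> {0..1}"
    using interval_part_subset[OF assms(3)] interval_part_subset[OF assms(4)] assms(1,2) by auto
  have ind: "indicator (interval_part n i') x = (of_bool (i' = i) :: real)"
    "indicator (interval_part n i') y = (of_bool (i' = j) :: real)" if "i' < n" for i'
    using interval_part_iff[OF x] interval_part_iff[OF y] assms that by (auto simp: indicator_def)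
  have "(\<Sum>i'<n. \<Sum>j'<n. of_bool ({i', j'} \<in> G) *
      indicator (interval_part n i' \<times> interval_part n j') (x, y)) =
    (\<Sum>i'<n. if i' = i then (\<Sum>j'<n. if j' = j then of_bool ({i, j} \<in> G) else 0 :: real) else 0)"
    by (intro sum.cong refl) (simp add: indicator_times ind cong: if_cong)
  then show ?thesis using assms(3,4) by (simp add: step_graphon_signal_def)
qed

lemma ex_interval_part:
  assumes "x \<in> {0..1}" "n \<ge> 1"
  obtains i where "i < n" "x \<in> interval_part n i"
proof -
  let ?i = "min (n - 1) (nat \<lfloor>x * n\<rfloor>)"
  have "?i < n" using assms(2) by simp
  moreover have "x \<in> interval_part n ?i" using interval_part_iff[OF assms(1) \<open>?i < n\<close>] by simp
  ultimately show ?thesis by (rule that)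
qed

text \<open>Each value \<open>v i\<close> is taken on an interval of positive length 1/n, so an
  almost everywhere bound on the step signal bounds every value. The direction from membership to
  the bound serves to recognise exactly which samples fall outside
  \<open>graphon_signals r\<close>.\<close>

lemma step_graphon_signal_mem_iff:
  assumes "n \<ge> 1" "0 \<le> r"
  shows "step_graphon_signal n (G, v) \<in> graphon_signals r \<longleftrightarrow> (\<forall>i<n. \<bar>v i\<bar> \<le> r)"
proof -
  interpret U: prob_space unit_measure by (rule prob_space_unit_measure)
  let ?W = "fst (step_graphon_signal n (G, v))" and ?f = "snd (step_graphon_signal n (G, v))"
  have W: "?W \<in> borel_measurable (unit_measure \<Otimes>\<^sub>M unit_measure)"
  proof -
    have [measurable]: "interval_part n i \<times> interval_part n j \<in> sets (unit_measure \<Otimes>\<^sub>M unit_measure)"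
      if "i \<in> {..<n}" "j \<in> {..<n}" for i j
      using that by auto
    show ?thesis
      unfolding step_graphon_signal_def prod.case fst_conv
      by (intro borel_measurable_sum borel_measurable_times borel_measurable_const
          borel_measurable_indicator) auto
  qed
  have f: "?f \<in> borel_measurable unit_measure"
    unfolding step_graphon_signal_def prod.case snd_conv
    by (intro borel_measurable_sum borel_measurable_times borel_measurable_const
        borel_measurable_indicator) auto
  have W01: "?W (x, y) \<in> {0..1} \<and> ?W (x, y) = ?W (y, x)"
    if xy: "x \<in> {0..1}" "y \<in> {0..1}" for x y
  proof -
    obtain i where i: "i < n" "x \<in> interval_part n i"
      using ex_interval_part[OF xy(1) assms(1)] .
    obtain j where j: "j < n" "y \<in> interval_part n j"
      using ex_interval_part[OF xy(2) assms(1)] .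
    show ?thesis
      using i j by (simp add: step_graphon_signal_graphon insert_commute)
  qed
  have fr: "(AE x in unit_measure. \<bar>?f x\<bar> \<le> r) \<longleftrightarrow> (\<forall>i<n. \<bar>v i\<bar> \<le> r)"
  proof
    assume AE: "AE x in unit_measure. \<bar>?f x\<bar> \<le> r"
    show "\<forall>i<n. \<bar>v i\<bar> \<le> r"
    proof (intro allI impI, rule ccontr)
      fix i assume i: "i < n" "\<not> \<bar>v i\<bar> \<le> r"
      have "AE x in unit_measure. x \<notin> interval_part n i"
        using AE by eventually_elim (use i in \<open>auto simp: step_graphon_signal_signal\<close>)
      then have "measure unit_measure (interval_part n i) = 0"
        using i by (subst U.prob_eq_0) auto
      then show False using i by (simp add: measure_interval_part)
    qed
  next
    assume v: "\<forall>i<n. \<bar>v i\<bar> \<le> r"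
    show "AE x in unit_measure. \<bar>?f x\<bar> \<le> r"
    proof (rule AE_I2)
      fix x assume "x \<in> space unit_measure"
      then have "x \<in> {0..1}" by simp
      then obtain i where "i < n" "x \<in> interval_part n i" using ex_interval_part assms(1) by blast
      then show "\<bar>?f x\<bar> \<le> r" using v by (simp add: step_graphon_signal_signal)
    qed
  qed
  show ?thesis
    using W f W01 fr unfolding graphon_signals_def by (auto simp: case_prod_unfold)
qed

text \<open>The contribution of a single vertex map \<open>\<phi>\<close> to a sampled density.
  Edges enter as a set \<open>S\<close>, not as a multiset, because the step graphon is 0/1-valued.
  If \<open>\<phi>\<close> collapses an edge, its image is a singleton, matching the diagonal blocks
  of the step graphon.\<close>

definition step_summand ::
  "nat \<Rightarrow> nat set set \<Rightarrow> (nat \<Rightarrow> nat) \<Rightarrow> (nat \<Rightarrow> nat) \<Rightarrow> graph_signal \<Rightarrow> real" where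
  "step_summand k S d \<phi> = (\<lambda>(G, v). (\<Prod>i<k. v (\<phi> i) ^ d i) * of_bool (\<forall>e\<in>S. \<phi> ` e \<in> G))"

text \<open>The cube splits into n^k boxes, indexed by the maps \<open>\<phi>\<close>. The integrand
  is constant on each box, with value \<open>step_summand\<close>, and each box has volume
  n^(-k).\<close>

lemma hom_density_step_graphon_signal:
  assumes "n \<ge> 1" "set_mset E \<subseteq> pairs k"
  shows "hom_density k E d (step_graphon_signal n Gv) =
    (\<Sum>\<phi>\<in>{..<k} \<rightarrow>\<^sub>E {..<n}. step_summand k (set_mset E) d \<phi> Gv) / real n ^ k"
proof -
  obtain G v where Gv: "Gv = (G, v)" by fastforce
  interpret U: prob_space unit_measure by (rule prob_space_unit_measure)
  interpret P: product_prob_space "\<lambda>_::nat. unit_measure" ..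
  let ?S = "step_graphon_signal n (G, v)" and ?\<Phi> = "{..<k} \<rightarrow>\<^sub>E {..<n}"
  let ?c = "\<lambda>\<phi>. step_summand k (set_mset E) d \<phi> (G, v)"
  have fin: "finite ?\<Phi>" by (simp add: finite_PiE)
  have pointwise: "(\<Prod>i<k. snd ?S (x i) ^ d i) * (\<Prod>e\<in>#E. edge_value (fst ?S) x e) =
      (\<Sum>\<phi>\<in>?\<Phi>. ?c \<phi> * (\<Prod>i<k. indicator (interval_part n (\<phi> i)) (x i)))"
    if "x \<in> space (PiM {..<k} (\<lambda>_. unit_measure))" for x
  proof -
    have x: "x i \<in> {0..1}" if "i < k" for i
      using \<open>x \<in> _\<close> that by (auto simp: space_PiM PiE_iff)
    \<comment> \<open>\<open>\<psi>\<close> indexes the box containing \<open>x\<close>; in the sum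
      over all boxes only its indicator is nonzero.\<close>
    define \<psi> where "\<psi> = (\<lambda>i\<in>{..<k}. min (n - 1) (nat \<lfloor>x i * n\<rfloor>))"
    have \<psi>: "\<psi> i < n" "x i \<in> interval_part n (\<psi> i)" if "i < k" for i
    proof -
      show "\<psi> i < n" using that assms(1) by (simp add: \<psi>_def)
      then show "x i \<in> interval_part n (\<psi> i)"
        using interval_part_iff[OF x[OF that]] that by (simp add: \<psi>_def)
    qed
    have "(\<Prod>i<k. indicator (interval_part n (\<phi> i)) (x i)) = (of_bool (\<phi> = \<psi>) :: real)"
      if \<phi>: "\<phi> \<in> ?\<Phi>" for \<phi>
    proof (cases "\<phi> = \<psi>")
      case False
      have "\<psi> \<in> extensional {..<k}" "\<phi> \<in> extensional {..<k}"
        using \<phi> by (auto simp: \<psi>_def PiE_iff)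
      then obtain i where i: "i < k" "\<phi> i \<noteq> \<psi> i"
        using False extensionalityI by (metis lessThan_iff)
      then have "x i \<notin> interval_part n (\<phi> i)"
        using \<phi> interval_part_iff[OF x[OF i(1)], of "\<phi> i" n] by (auto simp: \<psi>_def PiE_iff)
      then show ?thesis using False i by (auto simp: indicator_def)
    qed (use \<psi> in simp)
    then have "(\<Sum>\<phi>\<in>?\<Phi>. ?c \<phi> * (\<Prod>i<k. indicator (interval_part n (\<phi> i)) (x i))) =
        (\<Sum>\<phi>\<in>?\<Phi>. if \<phi> = \<psi> then ?c \<phi> else 0)"
      by (intro sum.cong) auto
    also have "\<dots> = ?c \<psi>"
    proof -
      have "\<psi> \<in> ?\<Phi>" using \<psi> by (auto simp: \<psi>_def)
      then show ?thesis using fin by simp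
    qed
    also have "\<dots> = (\<Prod>i<k. snd ?S (x i) ^ d i) * (\<Prod>e\<in>#E. edge_value (fst ?S) x e)"
    proof -
      have "edge_value (fst ?S) x e = of_bool (\<psi> ` e \<in> G)" if "e \<in># E" for e
      proof -
        have e: "e \<in> pairs k" using that assms(2) by auto
        have "\<psi> ` e = {\<psi> (Min e), \<psi> (Max e)}"
          using pairs_eq_Min_Max(1)[OF e] by (metis image_insert image_empty)
        then show ?thesis
          using pairs_Min_Max[OF e] \<psi>
          by (simp add: edge_value_def step_graphon_signal_graphon)
      qed
      then have "(\<Prod>e\<in>#E. edge_value (fst ?S) x e) = of_bool (\<forall>e\<in>#E. \<psi> ` e \<in> G)"
        by (simp add: prod_mset_of_bool[symmetric] cong: image_mset_cong)
      moreover have "snd ?S (x i) = v (\<psi> i)" if "i < k" for i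
        using \<psi>[OF that] by (simp add: step_graphon_signal_signal)
      ultimately show ?thesis by (simp add: step_summand_def)
    qed
    finally show ?thesis by simp
  qed
  have indi: "integrable unit_measure (indicator (interval_part n i) :: real \<Rightarrow> real)" if "i < n" for i
    using that by (auto intro!: integrable_real_indicator simp: less_top[symmetric])
  have "hom_density k E d ?S =
      (\<integral>x. (\<Sum>\<phi>\<in>?\<Phi>. ?c \<phi> * (\<Prod>i<k. indicator (interval_part n (\<phi> i)) (x i)))
        \<partial>PiM {..<k} (\<lambda>_. unit_measure))"
    unfolding hom_density_def case_prod_unfold
    by (intro Bochner_Integration.integral_cong refl) (use pointwise in simp)
  also have "\<dots> = (\<Sum>\<phi>\<in>?\<Phi>. ?c \<phi> * (\<integral>x. (\<Prod>i<k. indicator (interval_part n (\<phi> i)) (x i))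
        \<partial>PiM {..<k} (\<lambda>_. unit_measure)))"
  proof (subst Bochner_Integration.integral_sum)
    fix \<phi> assume "\<phi> \<in> ?\<Phi>"
    then show "integrable (PiM {..<k} (\<lambda>_. unit_measure))
       (\<lambda>x. ?c \<phi> * (\<Prod>i<k. indicator (interval_part n (\<phi> i)) (x i)))"
      by (intro integrable_mult_right P.product_integrable_prod indi) (auto simp: PiE_iff)
  qed simp
  also have "\<dots> = (\<Sum>\<phi>\<in>?\<Phi>. ?c \<phi> * (1 / real n ^ k))"
  proof (intro sum.cong refl arg_cong2[where f = "(*)"])
    fix \<phi> assume \<phi>: "\<phi> \<in> ?\<Phi>"
    have "(\<integral>x. (\<Prod>i<k. indicator (interval_part n (\<phi> i)) (x i)) \<partial>PiM {..<k} (\<lambda>_. unit_measure)) =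
        (\<Prod>i<k. integral\<^sup>L unit_measure (indicator (interval_part n (\<phi> i)) :: real \<Rightarrow> real))"
      using \<phi> indi by (intro P.product_integral_prod) (auto simp: PiE_iff)
    also have "\<dots> = (\<Prod>i<k. 1 / n)"
      using \<phi> by (intro prod.cong) (auto simp: PiE_iff measure_interval_part
          Int_absorb2 interval_part_subset)
    finally show "(\<integral>x. (\<Prod>i<k. indicator (interval_part n (\<phi> i)) (x i)) \<partial>PiM {..<k} (\<lambda>_. unit_measure)) =
        1 / real n ^ k"
      by (simp add: power_divide)
  qed
  finally show ?thesis by (simp add: Gv sum_divide_distrib)
qed

subsection \<open>Homomorphism densities of graphon-signals\<close>

definition hom_integrand ::
  "nat \<Rightarrow> nat set multiset \<Rightarrow> (nat \<Rightarrow> nat) \<Rightarrow> graphon_signal \<Rightarrow> (nat \<Rightarrow> real) \<Rightarrow> real" where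
  "hom_integrand k E d = (\<lambda>(W, f) x. (\<Prod>i<k. f (x i) ^ d i) * (\<Prod>e\<in>#E. edge_value W x e))"

lemma hom_density_eq_integral:
  "hom_density k E d w = (\<integral>x. hom_integrand k E d w x \<partial>PiM {..<k} (\<lambda>_. unit_measure))"
  by (simp add: hom_density_def hom_integrand_def case_prod_unfold)

lemma graphon_signalsD:
  assumes "(W, f) \<in> graphon_signals r"
  shows "W \<in> borel_measurable (unit_measure \<Otimes>\<^sub>M unit_measure)"
    and "f \<in> borel_measurable unit_measure"
    and "x \<in> {0..1} \<Longrightarrow> y \<in> {0..1} \<Longrightarrow> W (x, y) \<in> {0..1}"
    and "x \<in> {0..1} \<Longrightarrow> y \<in> {0..1} \<Longrightarrow> W (x, y) = W (y, x)"
    and "AE x in unit_measure. \<bar>f x\<bar> \<le> r"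
  using assms unfolding graphon_signals_def by blast+

lemma borel_measurable_edge_value:
  assumes "(W, f) \<in> graphon_signals r" "e \<in> pairs k"
  shows "(\<lambda>x. edge_value W x e) \<in> borel_measurable (PiM {..<k} (\<lambda>_. unit_measure))"
proof -
  note graphon_signalsD(1)[OF assms(1), measurable]
  show ?thesis
    unfolding edge_value_def by (measurable; use pairs_Min_Max[OF assms(2)] in simp)
qed

lemma edge_value_in_01:
  assumes "(W, f) \<in> graphon_signals r" "e \<in> pairs k"
    and "x \<in> space (PiM {..<k} (\<lambda>_. unit_measure))"
  shows "edge_value W x e \<in> {0..1}"
  using pairs_Min_Max[OF assms(2)] assms(3) unfolding edge_value_def
  by (intro graphon_signalsD(3)[OF assms(1)]) (auto simp: space_PiM PiE_iff)

lemma borel_measurable_hom_integrand: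
  assumes "w \<in> graphon_signals r" "set_mset E \<subseteq> pairs k"
  shows "hom_integrand k E d w \<in> borel_measurable (PiM {..<k} (\<lambda>_. unit_measure))"
proof -
  obtain W f where w: "w = (W, f)" by fastforce
  note graphon_signalsD(2)[OF assms(1)[unfolded w], measurable]
  have e: "(\<lambda>x. edge_value W x e) \<in> borel_measurable (PiM {..<k} (\<lambda>_. unit_measure))"
    if "e \<in># E" for e
    using that assms by (intro borel_measurable_edge_value[of _ f r]) (auto simp: w)
  then have "(\<lambda>x. \<Prod>e\<in>#E. edge_value W x e) \<in> borel_measurable (PiM {..<k} (\<lambda>_. unit_measure))"
    by (induction E) auto
  then show ?thesis
    unfolding hom_integrand_def w prod.case by measurable
qed

text \<open>The graphon lies in [0,1] at every point, so the edge factors cost nothing. The signal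
  is bounded only almost everywhere, which passes to the product space because each of the finitely
  many coordinates is uniform.\<close>

lemma AE_abs_hom_integrand_le:
  assumes "w \<in> graphon_signals r" "set_mset E \<subseteq> pairs k"
  shows "AE x in PiM {..<k} (\<lambda>_. unit_measure). \<bar>hom_integrand k E d w x\<bar> \<le> r ^ (\<Sum>i<k. d i)"
proof -
  obtain W f where w: "w = (W, f)" by fastforce
  have "AE x in PiM {..<k} (\<lambda>_. unit_measure). \<forall>i\<in>{..<k}. \<bar>f (x i)\<bar> \<le> r"
    using graphon_signalsD(5)[OF assms(1)[unfolded w]]
    by (intro AE_finite_allI AE_PiM_component[where M = "\<lambda>_. unit_measure"] prob_space_unit_measure) auto
  moreover have "AE x in PiM {..<k} (\<lambda>_. unit_measure). x \<in> space (PiM {..<k} (\<lambda>_. unit_measure))"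
    by (rule AE_space)
  ultimately show ?thesis
  proof eventually_elim
    case (elim x)
    have "\<bar>\<Prod>e\<in>#E. edge_value W x e\<bar> \<le> 1"
      using assms(2) elim(2) edge_value_in_01[of W f r]  assms(1)
    proof (induction E)
      case (add e E)
      have "edge_value W x e \<in> {0..1}" using add.prems w by auto
      moreover have "\<bar>\<Prod>e\<in>#E. edge_value W x e\<bar> \<le> 1" using add by auto
      ultimately show ?case by (auto simp: abs_mult intro: mult_le_one)
    qed simp
    moreover have "\<bar>\<Prod>i<k. f (x i) ^ d i\<bar> \<le> r ^ (\<Sum>i<k. d i)"
      unfolding abs_prod power_sum using elim(1)
      by (intro prod_mono) (auto simp: power_abs intro: power_mono)
    ultimately have "\<bar>\<Prod>i<k. f (x i) ^ d i\<bar> * \<bar>\<Prod>e\<in>#E. edge_value W x e\<bar> \<le> r ^ (\<Sum>i<k. d i) * 1"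
      by (intro mult_mono) auto
    then show ?case by (simp add: hom_integrand_def w abs_mult)
  qed
qed

lemma integrable_hom_integrand:
  assumes "w \<in> graphon_signals r" "set_mset E \<subseteq> pairs k"
  shows "integrable (PiM {..<k} (\<lambda>_. unit_measure)) (hom_integrand k E d w)"
proof -
  interpret P: prob_space "PiM {..<k} (\<lambda>_. unit_measure)"
    by (intro prob_space_PiM prob_space_unit_measure)
  show ?thesis
    using AE_abs_hom_integrand_le[OF assms] borel_measurable_hom_integrand[OF assms]
    by (intro P.integrable_const_bound[where B = "r ^ (\<Sum>i<k. d i)"]) auto
qed

lemma abs_hom_density_le:
  assumes "w \<in> graphon_signals r" "set_mset E \<subseteq> pairs k"
  shows "\<bar>hom_density k E d w\<bar> \<le> r ^ (\<Sum>i<k. d i)"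
proof -
  interpret P: prob_space "PiM {..<k} (\<lambda>_. unit_measure)"
    by (intro prob_space_PiM prob_space_unit_measure)
  have "\<bar>hom_density k E d w\<bar> \<le> P.expectation (\<lambda>x. \<bar>hom_integrand k E d w x\<bar>)"
    unfolding hom_density_eq_integral by (rule integral_abs_bound)
  also have "\<dots> \<le> P.expectation (\<lambda>_. r ^ (\<Sum>i<k. d i))"
    using AE_abs_hom_integrand_le[OF assms] integrable_hom_integrand[OF assms]
    by (intro integral_mono_AE) auto
  finally show ?thesis by (simp add: P.prob_space)
qed

text \<open>Fubini: the second multigraph is moved to the vertices from \<open>k\<close> to
  \<open>k + l - 1\<close>, so the integrand is a product of functions of disjoint blocks of
  variables. With both multigraphs equal, this exhibits the square of a density as a
  density.\<close>

lemma hom_density_disjoint_union: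
  assumes w: "w \<in> graphon_signals r" and E: "set_mset E \<subseteq> pairs k" and F: "set_mset F \<subseteq> pairs l"
  shows "hom_density (k + l) (E + image_mset ((`) ((+) k)) F) (\<lambda>i. if i < k then c i else d (i - k)) w =
    hom_density k E c w * hom_density l F d w"
proof -
  interpret U: prob_space unit_measure by (rule prob_space_unit_measure)
  interpret P: product_prob_space "\<lambda>_::nat. unit_measure" ..
  obtain W f where Wf: "w = (W, f)" by fastforce
  let ?EF = "E + image_mset ((`) ((+) k)) F" and ?cd = "\<lambda>i. if i < k then c i else d (i - k)"
  let ?I = "{..<k}" and ?J = "{k..<k + l}" and ?P = "\<lambda>I. PiM I (\<lambda>_. unit_measure)"
  let ?t = "\<lambda>y. \<lambda>i\<in>{..<l}. y (k + i)"
  have disj: "?I \<inter> ?J = {}" by auto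
  have IJ: "?I \<union> ?J = {..<k + l}" by auto
  have EF: "set_mset ?EF \<subseteq> pairs (k + l)"
  proof -
    have "(+) k ` e \<in> pairs (k + l)" if "e \<in># F" for e
      using that F by (intro image_pairs[of e l]) auto
    moreover have "pairs k \<subseteq> pairs (k + l)" by (auto simp: pairs_def)
    ultimately show ?thesis using E by auto
  qed
  have int: "integrable (?P (?I \<union> ?J)) (hom_integrand (k + l) ?EF ?cd w)"
    unfolding IJ by (rule integrable_hom_integrand[OF w EF])
  have split: "hom_integrand (k + l) ?EF ?cd w (merge ?I ?J (x, y)) =
      hom_integrand k E c w x * hom_integrand l F d w (?t y)" for x y
  proof -
    let ?z = "merge ?I ?J (x, y)"
    have "(\<Prod>i<k + l. f (?z i) ^ ?cd i) = (\<Prod>i\<in>?I. f (?z i) ^ ?cd i) * (\<Prod>i\<in>?J. f (?z i) ^ ?cd i)"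
      unfolding IJ[symmetric] by (rule prod.union_disjoint) auto
    also have "(\<Prod>i\<in>?J. f (?z i) ^ ?cd i) = (\<Prod>i<l. f (?z (k + i)) ^ ?cd (k + i))"
      by (rule prod.reindex_bij_witness[of _ "\<lambda>i. k + i" "\<lambda>i. i - k"]) auto
    finally have 1: "(\<Prod>i<k + l. f (?z i) ^ ?cd i) = (\<Prod>i<k. f (x i) ^ c i) * (\<Prod>i<l. f (?t y i) ^ d i)"
      by (simp add: merge_def)
    have 2: "edge_value W ?z e = edge_value W x e" if "e \<in># E" for e
      using that E pairs_Min_Max[of e k] by (auto simp: edge_value_def merge_def)
    have 3: "edge_value W ?z ((+) k ` e) = edge_value W (?t y) e" if "e \<in># F" for e
    proof -
      have e: "e \<in> pairs l" using that F by auto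
      \<comment> \<open>The shift is increasing, so smaller and larger endpoint keep their roles and
        \<open>edge_value\<close> reads \<open>W\<close> at the same ordered pair.\<close>
      have "(+) k ` e = {k + Min e, k + Max e}"
        using pairs_eq_Min_Max(1)[OF e] by (metis image_insert image_empty)
      then have "Min ((+) k ` e) = k + Min e" "Max ((+) k ` e) = k + Max e"
        using pairs_eq_Min_Max(2)[OF e] by auto
      then show ?thesis
        using pairs_Min_Max[OF e] by (simp add: edge_value_def merge_def)
    qed
    have "(\<Prod>e\<in>#?EF. edge_value W ?z e) =
        (\<Prod>e\<in>#E. edge_value W x e) * (\<Prod>e\<in>#F. edge_value W (?t y) e)"
      using 2 3 by (simp add: image_mset.compositionality comp_def cong: image_mset_cong)
    then show ?thesis by (simp add: hom_integrand_def Wf 1)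
  qed
  have "hom_density (k + l) ?EF ?cd w =
      (\<integral>x. (\<integral>y. hom_integrand k E c w x * hom_integrand l F d w (?t y) \<partial>?P ?J) \<partial>?P ?I)"
    using P.product_integral_fold[OF disj _ _ int] unfolding IJ hom_density_eq_integral split by simp
  also have "\<dots> = hom_density k E c w * (\<integral>y. hom_integrand l F d w (?t y) \<partial>?P ?J)"
    by (simp add: hom_density_eq_integral)
  also have "(\<integral>y. hom_integrand l F d w (?t y) \<partial>?P ?J) = hom_density l F d w"
  proof -
    have t: "?t \<in> ?P ?J \<rightarrow>\<^sub>M ?P {..<l}"
      by (rule measurable_restrict) (auto intro: measurable_component_singleton)
    have d: "distr (?P ?J) (?P {..<l}) ?t = ?P {..<l}"
      using P.distr_reorder[of "(+) k" "{..<l}" ?J] by auto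
    show ?thesis
      unfolding hom_density_eq_integral
      by (rule integral_distr[OF t borel_measurable_hom_integrand[OF w F], unfolded d, symmetric])
  qed
  finally show ?thesis .
qed

subsection \<open>Expectations under the sampling law\<close>

text \<open>
  Sampled signal values are bounded by \<open>r\<close> only almost surely; clipping them makes densities
  bounded and measurable on the whole of \<open>graph_signal_space n\<close>.
\<close>

definition clip_signal :: "real \<Rightarrow> ('a \<Rightarrow> real) \<Rightarrow> 'a \<Rightarrow> real" where
  "clip_signal r v = (\<lambda>i. max (- r) (min r (v i)))"

lemma abs_clip_signal_le: "0 \<le> r \<Longrightarrow> \<bar>clip_signal r v i\<bar> \<le> r"
  by (auto simp: clip_signal_def)

lemma clip_signal_eq: "\<bar>v i\<bar> \<le> r \<Longrightarrow> clip_signal r v i = v i"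
  by (auto simp: clip_signal_def)

lemma clip_signal_mem_graphon_signals:
  assumes "(W, f) \<in> graphon_signals r" "0 \<le> r"
  shows "(W, clip_signal r f) \<in> graphon_signals r"
proof -
  note graphon_signalsD(2)[OF assms(1), measurable]
  have "clip_signal r f \<in> borel_measurable unit_measure"
    unfolding clip_signal_def by measurable
  then show ?thesis
    using assms by (simp add: graphon_signals_def abs_clip_signal_le)
qed

lemma step_clip_signal_mem_graphon_signals:
  "n \<ge> 1 \<Longrightarrow> 0 \<le> r \<Longrightarrow> step_graphon_signal n (G, clip_signal r v) \<in> graphon_signals r"
  by (simp add: step_graphon_signal_mem_iff abs_clip_signal_le)

lemma space_graph_signal_space:
  "space (graph_signal_space n) = Pow (pairs n) \<times> ({..<n} \<rightarrow>\<^sub>E UNIV)"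
  by (simp add: graph_signal_space_def space_pair_measure space_PiM)

lemma sample_pair_measurable:
  assumes "(W, f) \<in> graphon_signals r" "x \<in> space (PiM {..<n} (\<lambda>_. unit_measure))"
  shows "(\<lambda>G. (G, \<lambda>i\<in>{..<n}. f (x i))) \<in>
    restrict_space (measure_pmf (independent_edges n p)) (Pow (pairs n)) \<rightarrow>\<^sub>M graph_signal_space n"
proof -
  have "sets (restrict_space (measure_pmf (independent_edges n p)) (Pow (pairs n))) =
      sets (count_space (Pow (pairs n)))"
    by (auto simp: sets_restrict_space)
  note eq = measurable_cong_sets[OF this refl]
  show ?thesis
    unfolding eq by (auto simp: space_graph_signal_space)
qed

lemma measurable_sample_kernel_subprob:
  "(W, f) \<in> graphon_signals r \<Longrightarrow> sample_kernel n (W, f)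
    \<in> PiM {..<n} (\<lambda>_. unit_measure) \<rightarrow>\<^sub>M subprob_algebra (graph_signal_space n)"
  by (rule measurable_prob_algebraD[OF measurable_sample_kernel])

text \<open>Given the sample points, the signal component is deterministic, so the claim reduces to
  the essential bound on \<open>f\<close> at finitely many uniform points.\<close>

lemma AE_sample_law_abs_le:
  assumes "(W, f) \<in> graphon_signals r"
  shows "AE Gv in sample_law n (W, f). \<forall>i<n. \<bar>snd Gv i\<bar> \<le> r"
proof -
  have pred: "Measurable.pred (graph_signal_space n) (\<lambda>Gv. \<forall>i<n. \<bar>snd Gv i\<bar> \<le> r)"
  proof -
    have [measurable]: "(\<lambda>Gv. snd Gv i) \<in> borel_measurable (graph_signal_space n)" if "i < n" for i
      using that unfolding graph_signal_space_def
      by (intro measurable_compose[OF measurable_snd measurable_component_singleton]) auto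
    have "Measurable.pred (graph_signal_space n) (\<lambda>Gv. \<forall>i\<in>{..<n}. \<bar>snd Gv i\<bar> \<le> r)"
      by (intro pred_intros_finite) auto
    then show ?thesis by simp
  qed
  have "AE x in PiM {..<n} (\<lambda>_. unit_measure). \<forall>i\<in>{..<n}. \<bar>f (x i)\<bar> \<le> r"
    using graphon_signalsD(5)[OF assms]
    by (intro AE_finite_allI AE_PiM_component[where M = "\<lambda>_. unit_measure"] prob_space_unit_measure) auto
  moreover have "AE x in PiM {..<n} (\<lambda>_. unit_measure). x \<in> space (PiM {..<n} (\<lambda>_. unit_measure))"
    by (rule AE_space)
  ultimately have "AE x in PiM {..<n} (\<lambda>_. unit_measure). AE Gv in sample_kernel n (W, f) x.
      \<forall>i<n. \<bar>snd Gv i\<bar> \<le> r"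
  proof eventually_elim
    case (elim x)
    show ?case
      unfolding sample_kernel_def prod.case
      using elim(1)
      by (subst AE_distr_iff[OF sample_pair_measurable[OF assms elim(2)] predE[OF pred]]) simp
  qed
  then show ?thesis
    unfolding sample_law_def
    by (rule iffD2[OF AE_bind[OF measurable_sample_kernel_subprob[OF assms] pred]])
qed

text \<open>Two-stage expectation: the edges are averaged out for fixed sample points, then the
  points are integrated. The bound on \<open>g\<close> is asked for at every point of the space,
  which clipped densities satisfy.\<close>

lemma integral_sample_law:
  fixes g :: "graph_signal \<Rightarrow> real"
  assumes Wf: "(W, f) \<in> graphon_signals r"
    and g: "g \<in> borel_measurable (graph_signal_space n)"
    and B: "\<And>Gv. Gv \<in> space (graph_signal_space n) \<Longrightarrow> \<bar>g Gv\<bar> \<le> B"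
  shows "integrable (sample_law n (W, f)) g"
    and "integral\<^sup>L (sample_law n (W, f)) g =
      (\<integral>x. measure_pmf.expectation (independent_edges n (edge_value W x))
        (\<lambda>G. g (G, \<lambda>i\<in>{..<n}. f (x i))) \<partial>PiM {..<n} (\<lambda>_. unit_measure))"
proof -
  let ?P = "PiM {..<n} (\<lambda>_. unit_measure)"
  interpret P: prob_space ?P by (intro prob_space_PiM prob_space_unit_measure)
  have "emeasure (sample_kernel n (W, f) x) (space (sample_kernel n (W, f) x)) \<le> ennreal 1"
    if "x \<in> space ?P" for x
    using measurable_space[OF measurable_sample_kernel_subprob[OF Wf] that]
    by (auto simp: space_subprob_algebra intro: subprob_space.emeasure_space_le_1)
  then have mass: "AE x in ?P. emeasure (sample_kernel n (W, f) x) (space (sample_kernel n (W, f) x))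
      \<le> ennreal 1"
    by (rule AE_I2)
  note bind = g B measurable_sample_kernel_subprob[OF Wf] P.finite_measure_axioms mass
  show "integrable (sample_law n (W, f)) g"
    unfolding sample_law_def by (rule integrable_bind[OF bind])
  have "integral\<^sup>L (sample_law n (W, f)) g = (\<integral>x. integral\<^sup>L (sample_kernel n (W, f) x) g \<partial>?P)"
    unfolding sample_law_def by (rule integral_bind[OF bind])
  also have "\<dots> = (\<integral>x. measure_pmf.expectation (independent_edges n (edge_value W x))
        (\<lambda>G. g (G, \<lambda>i\<in>{..<n}. f (x i))) \<partial>?P)"
  proof (rule Bochner_Integration.integral_cong[OF refl])
    fix x assume x: "x \<in> space ?P"
    let ?q = "independent_edges n (edge_value W x)"
    have "integral\<^sup>L (sample_kernel n (W, f) x) g =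
        (\<integral>G. g (G, \<lambda>i\<in>{..<n}. f (x i)) \<partial>restrict_space (measure_pmf ?q) (Pow (pairs n)))"
      unfolding sample_kernel_def prod.case
      by (rule integral_distr[OF sample_pair_measurable[OF Wf x] g])
    also have "\<dots> = measure_pmf.expectation ?q
        (\<lambda>G. indicator (Pow (pairs n)) G *\<^sub>R g (G, \<lambda>i\<in>{..<n}. f (x i)))"
      by (rule integral_restrict_space) auto
    also have "\<dots> = measure_pmf.expectation ?q (\<lambda>G. g (G, \<lambda>i\<in>{..<n}. f (x i)))"
      using set_independent_edges[of n "edge_value W x"]
      by (intro integral_cong_AE) (auto simp: AE_measure_pmf_iff indicator_def)
    finally show "integral\<^sup>L (sample_kernel n (W, f) x) g =
        measure_pmf.expectation ?q (\<lambda>G. g (G, \<lambda>i\<in>{..<n}. f (x i)))" .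
  qed
  finally show "integral\<^sup>L (sample_law n (W, f)) g =
      (\<integral>x. measure_pmf.expectation (independent_edges n (edge_value W x))
        (\<lambda>G. g (G, \<lambda>i\<in>{..<n}. f (x i))) \<partial>?P)" .
qed

text \<open>The indicator that all of \<open>T\<close> is present is a product over all pairs, with
  factor 1 for pairs outside \<open>T\<close>. Independence turns its expectation into a product of
  expectations.\<close>

lemma expectation_independent_edges:
  assumes p: "\<And>e. e \<in> pairs n \<Longrightarrow> p e \<in> {0..1}" and T: "T \<subseteq> pairs n"
  shows "measure_pmf.expectation (independent_edges n p) (\<lambda>G. of_bool (T \<subseteq> G)) = (\<Prod>e\<in>T. p e)"
proof -
  have "measure_pmf.expectation (independent_edges n p) (\<lambda>G. of_bool (T \<subseteq> G)) =
      measure_pmf.expectation (Pi_pmf (pairs n) False (\<lambda>e. bernoulli_pmf (p e)))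
        (\<lambda>b. \<Prod>e\<in>pairs n. of_bool (e \<in> T \<longrightarrow> b e) :: real)"
  proof -
    have "of_bool (T \<subseteq> {e \<in> pairs n. b e}) = (\<Prod>e\<in>pairs n. of_bool (e \<in> T \<longrightarrow> b e) :: real)" for b
    proof -
      have "(\<Prod>e\<in>A. of_bool (P e)) = (of_bool (\<forall>e\<in>A. P e) :: real)" if "finite A" for A and P :: "nat set \<Rightarrow> bool"
        using that by induction auto
      moreover have "T \<subseteq> {e \<in> pairs n. b e} \<longleftrightarrow> (\<forall>e\<in>pairs n. e \<in> T \<longrightarrow> b e)"
        using T by auto
      ultimately show ?thesis by simp
    qed
    then show ?thesis
      unfolding independent_edges_def by (subst integral_map_pmf) (simp only:)
  qed
  also have "\<dots> = (\<Prod>e\<in>pairs n. measure_pmf.expectation (bernoulli_pmf (p e))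
      (\<lambda>b. of_bool (e \<in> T \<longrightarrow> b)))"
    by (rule expectation_prod_Pi_pmf) (auto intro: integrable_measure_pmf_finite)
  also have "\<dots> = (\<Prod>e\<in>pairs n. if e \<in> T then p e else 1)"
    using p by (intro prod.cong) auto
  also have "\<dots> = (\<Prod>e\<in>T. p e)"
    using T by (simp add: prod.If_cases Int_absorb1)
  finally show ?thesis .
qed

section \<open>Expectation of the contribution of one vertex map\<close>

lemma borel_measurable_step_summand:
  assumes "\<phi> \<in> {..<k} \<rightarrow> {..<n}"
  shows "(\<lambda>(G, v). step_summand k S d \<phi> (G, clip_signal r v)) \<in> borel_measurable (graph_signal_space n)"
proof -
  have "(\<lambda>Gv. snd Gv (\<phi> i)) \<in> borel_measurable (graph_signal_space n)" if "i < k" for i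
    using that assms unfolding graph_signal_space_def
    by (intro measurable_compose[OF measurable_snd measurable_component_singleton]) auto
  moreover have "(\<lambda>Gv. of_bool (\<forall>e\<in>S. \<phi> ` e \<in> fst Gv) :: real) \<in> borel_measurable (graph_signal_space n)"
    unfolding graph_signal_space_def
    by (rule measurable_compose[OF measurable_fst]) simp
  ultimately show ?thesis
    unfolding step_summand_def clip_signal_def case_prod_unfold fst_conv snd_conv
    by (intro borel_measurable_times borel_measurable_prod borel_measurable_power
        borel_measurable_max borel_measurable_min) auto
qed

lemma abs_step_summand_le:
  assumes "0 \<le> r"
  shows "\<bar>step_summand k S d \<phi> (G, clip_signal r v)\<bar> \<le> r ^ (\<Sum>i<k. d i)"
proof -
  have "\<bar>\<Prod>i<k. clip_signal r v (\<phi> i) ^ d i\<bar> \<le> r ^ (\<Sum>i<k. d i)"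
    unfolding abs_prod power_sum
    by (intro prod_mono) (auto simp: power_abs intro!: power_mono abs_clip_signal_le assms)
  then show ?thesis
    using assms by (auto simp: step_summand_def)
qed

text \<open>An injective \<open>\<phi>\<close> need not be increasing and may exchange the smaller
  and the larger endpoint; symmetry of \<open>W\<close> absorbs the exchange.\<close>

lemma edge_value_image:
  assumes Wf: "(W, f) \<in> graphon_signals r" and e: "e \<in> pairs k"
    and \<phi>: "inj_on \<phi> {..<k}" "\<phi> \<in> {..<k} \<rightarrow> {..<n}"
    and x: "x \<in> space (PiM {..<n} (\<lambda>_. unit_measure))"
  shows "edge_value W x (\<phi> ` e) = edge_value W (\<lambda>i\<in>{..<k}. x (\<phi> i)) e"
proof -
  let ?a = "\<phi> (Min e)" and ?b = "\<phi> (Max e)"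
  have lt: "Min e < k" "Max e < k" using pairs_Min_Max[OF e] by auto
  have "?a < n" "?b < n" using lt \<phi>(2) by auto
  then have "W (x ?a, x ?b) = W (x ?b, x ?a)"
    using x by (intro graphon_signalsD(4)[OF Wf]) (auto simp: space_PiM PiE_iff)
  moreover have "\<phi> ` e = {?a, ?b}"
    using pairs_eq_Min_Max(1)[OF e] by (metis image_insert image_empty)
  ultimately show ?thesis
    using lt by (auto simp: edge_value_def min_def max_def)
qed

text \<open>For injective \<open>\<phi>\<close> the images of distinct edges are distinct pairs, so
  given the points their indicators are independent with means W(x_i, x_j). The selected points are
  themselves independent and uniform. Hence the value depends neither on \<open>n\<close> nor on
  \<open>\<phi>\<close>, and \<open>mset_set S\<close> counts each edge once.\<close>

lemma integral_step_summand_inj: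
  assumes Wf: "(W, f) \<in> graphon_signals r" and r: "0 \<le> r" and S: "S \<subseteq> pairs k"
    and \<phi>: "inj_on \<phi> {..<k}" "\<phi> \<in> {..<k} \<rightarrow> {..<n}"
  shows "(\<integral>(G, v). step_summand k S d \<phi> (G, clip_signal r v) \<partial>sample_law n (W, f)) =
    hom_density k (mset_set S) d (W, clip_signal r f)"
proof -
  interpret U: prob_space unit_measure by (rule prob_space_unit_measure)
  interpret P: product_prob_space "\<lambda>_::nat. unit_measure" ..
  let ?P = "\<lambda>n. PiM {..<n::nat} (\<lambda>_. unit_measure)"
  let ?h = "hom_integrand k (mset_set S) d (W, clip_signal r f)"
  let ?t = "\<lambda>x. \<lambda>i\<in>{..<k}. x (\<phi> i)"
  have finS: "finite S" by (rule finite_subset[OF S finite_pairs])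
  have "(\<integral>(G, v). step_summand k S d \<phi> (G, clip_signal r v) \<partial>sample_law n (W, f)) =
      (\<integral>x. measure_pmf.expectation (independent_edges n (edge_value W x))
        (\<lambda>G. step_summand k S d \<phi> (G, clip_signal r (\<lambda>i\<in>{..<n}. f (x i)))) \<partial>?P n)"
    using abs_step_summand_le[OF r]
    by (subst integral_sample_law(2)[OF Wf borel_measurable_step_summand[OF \<phi>(2)]]) auto
  also have "\<dots> = (\<integral>x. ?h (?t x) \<partial>?P n)"
  proof (rule Bochner_Integration.integral_cong[OF refl])
    fix x assume x: "x \<in> space (?P n)"
    \<comment> \<open>Without this, two edges could share an image, and the product over the image
      set would lose a factor.\<close>
    have inj: "inj_on ((`) \<phi>) S"
      using S by (intro inj_on_subset[OF inj_on_image_Pow[OF \<phi>(1)]]) (auto simp: pairs_def)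
    have sub: "(`) \<phi> ` S \<subseteq> pairs n" using S \<phi> by (auto intro: image_pairs)
    have "measure_pmf.expectation (independent_edges n (edge_value W x))
        (\<lambda>G. of_bool (\<forall>e\<in>S. \<phi> ` e \<in> G)) =
      measure_pmf.expectation (independent_edges n (edge_value W x))
        (\<lambda>G. of_bool ((`) \<phi> ` S \<subseteq> G))"
      by (simp add: image_subset_iff)
    also have "\<dots> = (\<Prod>e\<in>(`) \<phi> ` S. edge_value W x e)"
      using sub edge_value_in_01[OF Wf _ x] by (rule expectation_independent_edges[rotated])
    also have "\<dots> = (\<Prod>e\<in>S. edge_value W (?t x) e)"
      using S by (subst prod.reindex[OF inj]) (auto intro!: prod.cong edge_value_image[OF Wf _ \<phi> x])
    finally have "measure_pmf.expectation (independent_edges n (edge_value W x))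
        (\<lambda>G. of_bool (\<forall>e\<in>S. \<phi> ` e \<in> G)) = (\<Prod>e\<in>S. edge_value W (?t x) e)" .
    \<comment> \<open>Clipping acts value by value, so clipping a sample amounts to sampling from
      the clipped signal. This is why \<open>clip_signal r f\<close> appears in the limit.\<close>
    moreover have "clip_signal r (\<lambda>i\<in>{..<n}. f (x i)) (\<phi> i) = clip_signal r f (?t x i)" if "i < k" for i
      using that \<phi>(2) by (auto simp: clip_signal_def)
    ultimately show "measure_pmf.expectation (independent_edges n (edge_value W x))
        (\<lambda>G. step_summand k S d \<phi> (G, clip_signal r (\<lambda>i\<in>{..<n}. f (x i)))) = ?h (?t x)"
      by (simp add: step_summand_def hom_integrand_def prod_unfold_prod_mset[symmetric])
  qed
  also have "\<dots> = integral\<^sup>L (?P k) ?h"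
  proof -
    have t: "?t \<in> ?P n \<rightarrow>\<^sub>M ?P k"
      using \<phi>(2) by (intro measurable_restrict measurable_component_singleton) auto
    \<comment> \<open>Reading \<open>k\<close> distinct coordinates of a product of \<open>n\<close>
      copies gives the product of \<open>k\<close> copies; distinctness is the injectivity of
      \<open>\<phi>\<close>.\<close>
    have d: "distr (?P n) (?P k) ?t = ?P k"
      using P.distr_reorder[OF \<phi>] by simp
    have "?h \<in> borel_measurable (?P k)"
      using S finS clip_signal_mem_graphon_signals[OF Wf r]
      by (intro borel_measurable_hom_integrand) auto
    then show ?thesis
      by (rule integral_distr[OF t, unfolded d, symmetric])
  qed
  finally show ?thesis by (simp add: hom_density_eq_integral)
qed

subsection \<open>Concentration of sampled densities\<close>

text \<open>Union bound over colliding vertices: if \<open>i\<close> and \<open>j\<close> collide,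
  the value at \<open>j\<close> is determined by the other \<open>k - 1\<close> values.\<close>

lemma card_PiE_not_inj_le:
  "card {\<phi> \<in> {..<k} \<rightarrow>\<^sub>E {..<n}. \<not> inj_on \<phi> {..<k}} \<le> k\<^sup>2 * n ^ (k - 1)"
proof -
  let ?\<Phi> = "{..<k} \<rightarrow>\<^sub>E {..<n}"
  \<comment> \<open>The condition \<open>i \<noteq> j\<close> makes diagonal pairs contribute the
    empty set, so the union may run over the full square, giving the factor k^2.\<close>
  let ?C = "\<lambda>(i, j). {\<phi> \<in> ?\<Phi>. i \<noteq> j \<and> \<phi> i = \<phi> j}"
  have fin: "finite ?\<Phi>" by (simp add: finite_PiE)
  have C: "card (?C (i, j)) \<le> n ^ (k - 1)" if ij: "i < k" "j < k" for i j
  proof (cases "i = j")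
    case False
    let ?R = "({..<k} - {j}) \<rightarrow>\<^sub>E {..<n}"
    have "card (?C (i, j)) \<le> card ?R"
    proof (rule card_inj_on_le[where f = "\<lambda>\<phi>. restrict \<phi> ({..<k} - {j})"])
      show "inj_on (\<lambda>\<phi>. restrict \<phi> ({..<k} - {j})) (?C (i, j))"
      proof (rule inj_onI)
        fix \<phi> \<psi> assume \<phi>: "\<phi> \<in> ?C (i, j)" and \<psi>: "\<psi> \<in> ?C (i, j)"
          and eq: "restrict \<phi> ({..<k} - {j}) = restrict \<psi> ({..<k} - {j})"
        have off: "\<phi> m = \<psi> m" if "m < k" "m \<noteq> j" for m
          using fun_cong[OF eq, of m] that by simp
        then have "\<phi> j = \<psi> j" using \<phi> \<psi> off[of i] ij False by auto
        with off have "\<phi> m = \<psi> m" if "m < k" for m using that by (cases "m = j") auto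
        then show "\<phi> = \<psi>" using \<phi> \<psi> by (intro PiE_ext[of \<phi> "{..<k}" "\<lambda>_. {..<n}"]) auto
      qed
      show "(\<lambda>\<phi>. restrict \<phi> ({..<k} - {j})) ` ?C (i, j) \<subseteq> ?R"
        by (intro image_subsetI restrict_PiE_iff[THEN iffD2]) (simp add: PiE_iff)
      show "finite ?R" by (simp add: finite_PiE)
    qed
    also have "card ?R = n ^ (k - 1)" using ij by (simp add: card_PiE)
    finally show ?thesis .
  qed simp
  have "{\<phi> \<in> ?\<Phi>. \<not> inj_on \<phi> {..<k}} \<subseteq> (\<Union>p\<in>{..<k} \<times> {..<k}. ?C p)"
    by (auto simp: inj_on_def)
  then have "card {\<phi> \<in> ?\<Phi>. \<not> inj_on \<phi> {..<k}} \<le> card (\<Union>p\<in>{..<k} \<times> {..<k}. ?C p)"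
    using fin by (intro card_mono) auto
  also have "\<dots> \<le> (\<Sum>p\<in>{..<k} \<times> {..<k}. card (?C p))"
    by (rule card_UN_le) simp
  also have "\<dots> \<le> (\<Sum>p\<in>{..<k} \<times> {..<k}. n ^ (k - 1))"
    using C by (intro sum_mono) auto
  also have "\<dots> = k\<^sup>2 * n ^ (k - 1)"
    by (simp add: power2_eq_square)
  finally show ?thesis .
qed

section \<open>Mean and mean square deviation of a sampled density\<close>

lemma borel_measurable_sampled_density:
  assumes "n \<ge> 1" "set_mset E \<subseteq> pairs k"
  shows "(\<lambda>(G, v). hom_density k E d (step_graphon_signal n (G, clip_signal r v)))
    \<in> borel_measurable (graph_signal_space n)"
proof -
  have "(\<lambda>Gv. step_summand k (set_mset E) d \<phi> (fst Gv, clip_signal r (snd Gv)))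
      \<in> borel_measurable (graph_signal_space n)" if "\<phi> \<in> {..<k} \<rightarrow>\<^sub>E {..<n}" for \<phi>
    using borel_measurable_step_summand[of \<phi> k n "set_mset E" d r] that
    by (auto simp: case_prod_unfold)
  then show ?thesis
    unfolding hom_density_step_graphon_signal[OF assms] case_prod_unfold
    by (intro borel_measurable_divide borel_measurable_sum borel_measurable_const)
qed

lemma abs_sampled_density_le:
  assumes "n \<ge> 1" "0 \<le> r" "set_mset E \<subseteq> pairs k"
  shows "\<bar>hom_density k E d (step_graphon_signal n (G, clip_signal r v))\<bar> \<le> r ^ (\<Sum>i<k. d i)"
  using assms by (intro abs_hom_density_le step_clip_signal_mem_graphon_signals)

lemma integrable_sampled_density:
  assumes "(W, f) \<in> graphon_signals r" "0 \<le> r" "n \<ge> 1" "set_mset E \<subseteq> pairs k"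
  shows "integrable (sample_law n (W, f))
    (\<lambda>(G, v). hom_density k E d (step_graphon_signal n (G, clip_signal r v)))"
  using borel_measurable_sampled_density[OF assms(3,4)] abs_sampled_density_le[OF assms(3,2,4)]
  by (intro integral_sample_law(1)[OF assms(1)]) auto

text \<open>Injective maps contribute exactly the limit. The others are at most a fraction k^2/n of
  all maps, and each is off by at most 2R with R = r^(sum of the exponents), which gives the rate 2
  R k^2 / n.\<close>

lemma tendsto_integral_sampled_density:
  assumes Wf: "(W, f) \<in> graphon_signals r" and r: "0 \<le> r" and E: "set_mset E \<subseteq> pairs k"
  shows "(\<lambda>n. \<integral>(G, v). hom_density k E d (step_graphon_signal n (G, clip_signal r v))
      \<partial>sample_law n (W, f)) \<longlonglongrightarrow> hom_density k (mset_set (set_mset E)) d (W, clip_signal r f)"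
    (is "?I \<longlonglongrightarrow> ?L")
proof -
  let ?R = "r ^ (\<Sum>i<k. d i)"
  have bound: "\<bar>?I n - ?L\<bar> \<le> 2 * ?R * k\<^sup>2 / n" if n: "n \<ge> 1" for n
  proof -
    let ?\<Phi> = "{..<k} \<rightarrow>\<^sub>E {..<n}"
    let ?c = "\<lambda>\<phi>. \<integral>(G, v). step_summand k (set_mset E) d \<phi> (G, clip_signal r v) \<partial>sample_law n (W, f)"
    interpret S: prob_space "sample_law n (W, f)" by (rule prob_space_sample_law(1)[OF Wf])
    have fin: "finite ?\<Phi>" by (simp add: finite_PiE)
    have int: "integrable (sample_law n (W, f))
        (\<lambda>(G, v). step_summand k (set_mset E) d \<phi> (G, clip_signal r v))" if "\<phi> \<in> ?\<Phi>" for \<phi>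
    proof (rule integral_sample_law(1)[OF Wf borel_measurable_step_summand])
      show "\<phi> \<in> {..<k} \<rightarrow> {..<n}" using that by auto
    qed (use abs_step_summand_le[OF r] in auto)
    have c: "\<bar>?c \<phi>\<bar> \<le> ?R" if "\<phi> \<in> ?\<Phi>" for \<phi>
    proof -
      have "\<bar>?c \<phi>\<bar> \<le> S.expectation (\<lambda>Gv. \<bar>case Gv of (G, v) \<Rightarrow>
          step_summand k (set_mset E) d \<phi> (G, clip_signal r v)\<bar>)"
        by (rule integral_abs_bound)
      also have "\<dots> \<le> S.expectation (\<lambda>_. ?R)"
        using int[OF that] abs_step_summand_le[OF r] by (intro integral_mono) auto
      finally show ?thesis by (simp add: S.prob_space)
    qed
    have L: "\<bar>?L\<bar> \<le> ?R"
      using E by (intro abs_hom_density_le clip_signal_mem_graphon_signals[OF Wf r]) auto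
    have eq: "?c \<phi> = ?L" if "\<phi> \<in> ?\<Phi>" "inj_on \<phi> {..<k}" for \<phi>
      using that by (intro integral_step_summand_inj[OF Wf r E]) auto
    have "?I n = (\<Sum>\<phi>\<in>?\<Phi>. ?c \<phi>) / real n ^ k"
      unfolding hom_density_step_graphon_signal[OF n E] case_prod_unfold
      using int by (subst Bochner_Integration.integral_divide_zero, subst Bochner_Integration.integral_sum)
        (auto simp: case_prod_unfold)
    \<comment> \<open>There are exactly n^k vertex maps, so the limit can be subtracted from each
      summand of the average.\<close>
    then have "?I n - ?L = (\<Sum>\<phi>\<in>?\<Phi>. ?c \<phi> - ?L) / real n ^ k"
      using n by (simp add: sum_subtractf card_PiE diff_divide_distrib)
    also have "(\<Sum>\<phi>\<in>?\<Phi>. ?c \<phi> - ?L) = (\<Sum>\<phi>\<in>{\<phi>\<in>?\<Phi>. \<not> inj_on \<phi> {..<k}}. ?c \<phi> - ?L)"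
      using fin eq by (intro sum.mono_neutral_right) auto
    finally have "\<bar>?I n - ?L\<bar> = \<bar>\<Sum>\<phi>\<in>{\<phi>\<in>?\<Phi>. \<not> inj_on \<phi> {..<k}}. ?c \<phi> - ?L\<bar> / real n ^ k"
      by simp
    also have "\<dots> \<le> (card {\<phi>\<in>?\<Phi>. \<not> inj_on \<phi> {..<k}} * (2 * ?R)) / real n ^ k"
    proof (intro divide_right_mono order_trans[OF sum_abs] sum_bounded_above)
      fix \<phi> assume "\<phi> \<in> {\<phi>\<in>?\<Phi>. \<not> inj_on \<phi> {..<k}}"
      then show "\<bar>?c \<phi> - ?L\<bar> \<le> 2 * ?R" using c[of \<phi>] L by auto
    qed simp
    also have "\<dots> \<le> (real (k\<^sup>2 * n ^ (k - 1)) * (2 * ?R)) / real n ^ k"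
      using card_PiE_not_inj_le[of k n] r
      by (intro divide_right_mono mult_right_mono of_nat_mono) auto
    \<comment> \<open>The case split handles truncated \<open>k - 1\<close>: for
      \<open>k = 0\<close> both sides vanish through the factor k^2.\<close>
    also have "\<dots> = 2 * ?R * k\<^sup>2 / n"
      using n by (cases k) auto
    finally show ?thesis .
  qed
  have "(\<lambda>n. 2 * ?R * k\<^sup>2 / real n) \<longlonglongrightarrow> 0"
    by (rule lim_const_over_n)
  then have "(\<lambda>n. ?I n - ?L) \<longlonglongrightarrow> 0"
    by (rule Lim_null_comparison[rotated])
      (use bound in \<open>auto simp: eventually_sequentially intro!: exI[of _ 1]\<close>)
  then show ?thesis by (simp add: LIM_zero_iff)
qed

text \<open>This is nonnegativity of the variance of |X|.\<close>

lemma (in prob_space) expectation_abs_le_sqrt: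
  fixes X :: "'a \<Rightarrow> real"
  assumes "integrable M X" "integrable M (\<lambda>x. (X x)\<^sup>2)"
  shows "expectation (\<lambda>x. \<bar>X x\<bar>) \<le> sqrt (expectation (\<lambda>x. (X x)\<^sup>2))"
proof (rule real_le_rsqrt)
  show "(expectation (\<lambda>x. \<bar>X x\<bar>))\<^sup>2 \<le> expectation (\<lambda>x. (X x)\<^sup>2)"
    using variance_positive[of "\<lambda>x. \<bar>X x\<bar>"] variance_eq[of "\<lambda>x. \<bar>X x\<bar>"] assms by simp
qed

text \<open>The deviation is measured from the limit \<open>L\<close> rather than from the mean: E(U
  - L)^2 = E U^2 - 2 L E U + L^2 tends to L^2 - 2 L^2 + L^2 = 0, and its square root dominates E|U -
  L|. Here E U^2 is the mean of a sampled density for the doubled multigraph.\<close>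

lemma tendsto_sampled_density_L1:
  fixes d :: "nat \<Rightarrow> nat"
  assumes Wf: "(W, f) \<in> graphon_signals r" and r: "0 \<le> r" and E: "set_mset E \<subseteq> pairs k"
  defines "L \<equiv> hom_density k (mset_set (set_mset E)) d (W, clip_signal r f)"
  shows "(\<lambda>n. \<integral>(G, v). \<bar>hom_density k E d (step_graphon_signal n (G, clip_signal r v)) - L\<bar>
      \<partial>sample_law n (W, f)) \<longlonglongrightarrow> 0"
proof -
  let ?U = "\<lambda>n (G, v). hom_density k E d (step_graphon_signal n (G, clip_signal r v))"
  let ?law = "\<lambda>n. sample_law n (W, f)"
  define E2 where "E2 = E + image_mset ((`) ((+) k)) E"
  define d2 where "d2 = (\<lambda>i. if i < k then d i else d (i - k))"
  have shift: "(+) k ` e \<in> pairs (k + k)" if "e \<in> pairs k" for e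
    using that by (intro image_pairs[of e k]) auto
  have E2: "set_mset E2 \<subseteq> pairs (k + k)"
  proof -
    have "pairs k \<subseteq> pairs (k + k)" by (auto simp: pairs_def)
    then show ?thesis using E shift by (auto simp: E2_def)
  qed
  have square: "hom_density (k + k) E2 d2 w = (hom_density k E d w)\<^sup>2" if "w \<in> graphon_signals r" for w
    unfolding E2_def d2_def power2_eq_square by (rule hom_density_disjoint_union[OF that E E])
  have "hom_density (k + k) (mset_set (set_mset E2)) d2 (W, clip_signal r f) = L\<^sup>2"
  proof -
    let ?S = "set_mset E"
    have "inj_on ((`) ((+) k)) ?S" by (intro inj_on_image) simp
    then have img: "mset_set ((`) ((+) k) ` ?S) = image_mset ((`) ((+) k)) (mset_set ?S)"
      by (rule image_mset_mset_set[symmetric])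
    \<comment> \<open>The supports of the two copies must be disjoint for the simple graph of the
      doubled multigraph to be the doubled simple graph. They are, since shifted edges only use
      vertices from \<open>k\<close> on.\<close>
    have disj: "?S \<inter> (`) ((+) k) ` ?S = {}"
    proof (rule ccontr)
      assume "?S \<inter> (`) ((+) k) ` ?S \<noteq> {}"
      then obtain e where e: "e \<in> pairs k" "(+) k ` e \<in> pairs k" using E by blast
      then have "e \<noteq> {}" "(+) k ` e \<subseteq> {..<k}" by (auto simp: pairs_def)
      then show False by auto
    qed
    have "mset_set (set_mset E2) = mset_set ?S + image_mset ((`) ((+) k)) (mset_set ?S)"
      unfolding img[symmetric] E2_def using disj by (subst mset_set_Union[symmetric]) auto
    then show ?thesis
      using E unfolding d2_def L_def power2_eq_square
      by (simp add: hom_density_disjoint_union[OF clip_signal_mem_graphon_signals[OF Wf r]])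
  qed
  then have lim2: "(\<lambda>n. \<integral>(G, v). hom_density (k + k) E2 d2 (step_graphon_signal n (G, clip_signal r v))
      \<partial>?law n) \<longlonglongrightarrow> L\<^sup>2"
    using tendsto_integral_sampled_density[OF Wf r E2, of d2] by simp
  have lim1: "(\<lambda>n. integral\<^sup>L (?law n) (?U n)) \<longlonglongrightarrow> L"
    unfolding L_def by (rule tendsto_integral_sampled_density[OF Wf r E])
  let ?V = "\<lambda>n. (\<integral>(G, v). hom_density (k + k) E2 d2 (step_graphon_signal n (G, clip_signal r v))
      \<partial>?law n) - 2 * L * integral\<^sup>L (?law n) (?U n) + L\<^sup>2"
  have "?V \<longlonglongrightarrow> L\<^sup>2 - 2 * L * L + L\<^sup>2"
    by (intro tendsto_intros lim1 lim2)
  then have V: "(\<lambda>n. sqrt (?V n)) \<longlonglongrightarrow> 0"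
    using tendsto_real_sqrt by (fastforce simp: power2_eq_square)
  have le: "(\<integral>(G, v). \<bar>?U n (G, v) - L\<bar> \<partial>?law n) \<le> sqrt (?V n)" if n: "n \<ge> 1" for n
  proof -
    interpret S: prob_space "?law n" by (rule prob_space_sample_law(1)[OF Wf])
    have sq: "(\<lambda>(G, v). hom_density (k + k) E2 d2 (step_graphon_signal n (G, clip_signal r v))) =
        (\<lambda>Gv. (?U n Gv)\<^sup>2)"
      using square[OF step_clip_signal_mem_graphon_signals[OF n r]] by auto
    have int: "integrable (?law n) (?U n)" "integrable (?law n) (\<lambda>Gv. (?U n Gv)\<^sup>2)"
      using integrable_sampled_density[OF Wf r n E, of d] integrable_sampled_density[OF Wf r n E2, of d2]
      unfolding sq by auto
    have sq_diff: "(?U n Gv - L)\<^sup>2 = (?U n Gv)\<^sup>2 - 2 * L * ?U n Gv + L\<^sup>2" for Gv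
      by (simp add: power2_diff)
    have int2: "integrable (?law n) (\<lambda>Gv. ?U n Gv - L)" "integrable (?law n) (\<lambda>Gv. (?U n Gv - L)\<^sup>2)"
      unfolding sq_diff using int by auto
    have "S.expectation (\<lambda>Gv. (?U n Gv - L)\<^sup>2) = ?V n"
      unfolding sq sq_diff using int by (simp add: S.prob_space)
    then show ?thesis
      using S.expectation_abs_le_sqrt[OF int2] by (simp add: case_prod_unfold)
  qed
  show ?thesis
  proof (rule tendsto_sandwich[OF _ _ tendsto_const V])
    show "\<forall>\<^sub>F n in sequentially. 0 \<le> (\<integral>(G, v). \<bar>hom_density k E d
        (step_graphon_signal n (G, clip_signal r v)) - L\<bar> \<partial>?law n)"
      by (intro always_eventually allI Bochner_Integration.integral_nonneg) auto
    show "\<forall>\<^sub>F n in sequentially. (\<integral>(G, v). \<bar>hom_density k E d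
        (step_graphon_signal n (G, clip_signal r v)) - L\<bar> \<partial>?law n) \<le> sqrt (?V n)"
      using eventually_ge_at_top[of 1] by eventually_elim (use le in simp)
  qed
qed

subsection \<open>Uniform limits of densities\<close>

text \<open>The triangle inequality over the finitely many terms. \<open>L\<close> and
  \<open>B\<close> depend on \<open>P\<close> but not on \<open>n\<close>.\<close>

lemma linear_span_hom_densities_sampling:
  assumes Wf: "(W, f) \<in> graphon_signals r" and r: "0 \<le> r" and P: "P \<in> linear_span hom_densities"
  shows "\<exists>L B.
    (\<forall>n\<ge>1. (\<lambda>(G, v). P (step_graphon_signal n (G, clip_signal r v)))
      \<in> borel_measurable (graph_signal_space n)) \<and>
    (\<forall>n\<ge>1. \<forall>G v. \<bar>P (step_graphon_signal n (G, clip_signal r v))\<bar> \<le> B) \<and>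
    (\<lambda>n. \<integral>(G, v). \<bar>P (step_graphon_signal n (G, clip_signal r v)) - L\<bar> \<partial>sample_law n (W, f))
      \<longlonglongrightarrow> 0"
proof -
  obtain l and c :: "nat \<Rightarrow> real" and h where P: "P = (\<lambda>x. \<Sum>i<l. c i * h i x)"
    and h: "\<And>i. i < l \<Longrightarrow> h i \<in> hom_densities"
    using P unfolding linear_span_def by blast
  have "\<forall>i. \<exists>k E d. i < l \<longrightarrow> h i = hom_density k E d \<and> set_mset E \<subseteq> pairs k"
    using h unfolding hom_densities_def by blast
  then obtain k E d where hd: "\<And>i. i < l \<Longrightarrow> h i = hom_density (k i) (E i) (d i)"
    and E: "\<And>i. i < l \<Longrightarrow> set_mset (E i) \<subseteq> pairs (k i)"
    by metis
  define \<Lambda> where "\<Lambda> i = hom_density (k i) (mset_set (set_mset (E i))) (d i) (W, clip_signal r f)" for i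
  let ?L = "\<Sum>i<l. c i * \<Lambda> i" and ?B = "\<Sum>i<l. \<bar>c i\<bar> * r ^ (\<Sum>j<k i. d i j)"
  let ?S = "\<lambda>n Gv. step_graphon_signal n (fst Gv, clip_signal r (snd Gv))"
  let ?law = "\<lambda>n. sample_law n (W, f)"
  have meas: "(\<lambda>Gv. h i (?S n Gv)) \<in> borel_measurable (graph_signal_space n)" if "n \<ge> 1" "i < l" for n i
    using borel_measurable_sampled_density[OF that(1) E[OF that(2)], of "d i" r]
    by (simp add: hd[OF that(2)] case_prod_unfold)
  have 1: "(\<lambda>(G, v). P (step_graphon_signal n (G, clip_signal r v)))
      \<in> borel_measurable (graph_signal_space n)" if "n \<ge> 1" for n
    unfolding P case_prod_unfold using meas[OF that]
    by (intro borel_measurable_sum borel_measurable_times borel_measurable_const) auto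
  have 2: "\<bar>P (step_graphon_signal n (G, clip_signal r v))\<bar> \<le> ?B" if "n \<ge> 1" for n G v
    unfolding P
    by (intro order_trans[OF sum_abs] sum_mono)
      (auto simp: abs_mult hd intro!: mult_left_mono abs_sampled_density_le that r E)
  have int: "integrable (?law n) (\<lambda>Gv. \<bar>h i (?S n Gv) - \<Lambda> i\<bar>)" if "n \<ge> 1" "i < l" for n i
  proof -
    interpret S: prob_space "?law n" by (rule prob_space_sample_law(1)[OF Wf])
    show ?thesis
      using integrable_sampled_density[OF Wf r that(1) E[OF that(2)], of "d i"]
      by (simp add: hd[OF that(2)] case_prod_unfold)
  qed
  have "(\<lambda>n. \<Sum>i<l. \<bar>c i\<bar> * (\<integral>Gv. \<bar>h i (?S n Gv) - \<Lambda> i\<bar> \<partial>?law n)) \<longlonglongrightarrow> (\<Sum>i<l. \<bar>c i\<bar> * 0)"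
  proof (intro tendsto_sum tendsto_mult tendsto_const)
    fix i assume "i \<in> {..<l}"
    then show "(\<lambda>n. \<integral>Gv. \<bar>h i (?S n Gv) - \<Lambda> i\<bar> \<partial>?law n) \<longlonglongrightarrow> 0"
      using tendsto_sampled_density_L1[OF Wf r E[of i], of "d i"] by (simp add: hd \<Lambda>_def case_prod_unfold)
  qed
  then have lim: "(\<lambda>n. \<Sum>i<l. \<bar>c i\<bar> * (\<integral>Gv. \<bar>h i (?S n Gv) - \<Lambda> i\<bar> \<partial>?law n)) \<longlonglongrightarrow> 0"
    by simp
  have "(\<integral>Gv. \<bar>P (?S n Gv) - ?L\<bar> \<partial>?law n)
      \<le> (\<Sum>i<l. \<bar>c i\<bar> * (\<integral>Gv. \<bar>h i (?S n Gv) - \<Lambda> i\<bar> \<partial>?law n))" if n: "n \<ge> 1" for n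
  proof -
    have "(\<integral>Gv. \<bar>P (?S n Gv) - ?L\<bar> \<partial>?law n)
        \<le> (\<integral>Gv. (\<Sum>i<l. \<bar>c i\<bar> * \<bar>h i (?S n Gv) - \<Lambda> i\<bar>) \<partial>?law n)"
    proof (rule integral_mono')
      show "integrable (?law n) (\<lambda>Gv. \<Sum>i<l. \<bar>c i\<bar> * \<bar>h i (?S n Gv) - \<Lambda> i\<bar>)"
        using int[OF n] by (intro Bochner_Integration.integrable_sum integrable_mult_right) auto
      fix Gv
      have "P (?S n Gv) - ?L = (\<Sum>i<l. c i * (h i (?S n Gv) - \<Lambda> i))"
        by (simp add: P sum_subtractf right_diff_distrib)
      then show "\<bar>P (?S n Gv) - ?L\<bar> \<le> (\<Sum>i<l. \<bar>c i\<bar> * \<bar>h i (?S n Gv) - \<Lambda> i\<bar>)"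
        using sum_abs[of "\<lambda>i. c i * (h i (?S n Gv) - \<Lambda> i)" "{..<l}"] by (simp only: abs_mult)
    qed (auto intro: sum_nonneg)
    also have "\<dots> = (\<Sum>i<l. \<bar>c i\<bar> * (\<integral>Gv. \<bar>h i (?S n Gv) - \<Lambda> i\<bar> \<partial>?law n))"
      using int[OF n] by (subst Bochner_Integration.integral_sum) auto
    finally show ?thesis .
  qed
  then have le: "\<forall>\<^sub>F n in sequentially. (\<integral>Gv. \<bar>P (?S n Gv) - ?L\<bar> \<partial>?law n)
      \<le> (\<Sum>i<l. \<bar>c i\<bar> * (\<integral>Gv. \<bar>h i (?S n Gv) - \<Lambda> i\<bar> \<partial>?law n))"
    by (auto intro: eventually_mono[OF eventually_ge_at_top[of 1]])
  have "(\<lambda>n. \<integral>Gv. \<bar>P (?S n Gv) - ?L\<bar> \<partial>?law n) \<longlonglongrightarrow> 0"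
    by (rule tendsto_sandwich[OF _ le tendsto_const lim])
      (intro always_eventually allI Bochner_Integration.integral_nonneg, simp)
  then have 3: "(\<lambda>n. \<integral>(G, v). \<bar>P (step_graphon_signal n (G, clip_signal r v)) - ?L\<bar> \<partial>?law n)
      \<longlonglongrightarrow> 0"
    by (simp add: case_prod_unfold)
  show ?thesis using 1 2 3 by blast
qed

text \<open>Approximants control \<open>H\<close> only on \<open>graphon_signals r\<close>; the
  assumption \<open>const\<close> fixes it elsewhere, which makes the unclipped function measurable
  on the whole sample space. In the last claim \<open>L\<close> comes from an approximant chosen for
  \<open>\<epsilon>\<close>, so it precedes \<open>n\<close> but may change with
  \<open>\<epsilon>\<close>.\<close>

lemma uniform_closure_hom_densities_sampling:
  fixes H :: "graphon_signal \<Rightarrow> real"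
  assumes Wf: "(W, f) \<in> graphon_signals r" and r: "0 \<le> r"
    and H: "H \<in> uniform_closure (graphon_signals r) (linear_span hom_densities)"
    and const: "\<forall>x\<in>- graphon_signals r. H x = a"
  shows "n \<ge> 1 \<Longrightarrow> (\<lambda>Gv. H (step_graphon_signal n Gv)) \<in> borel_measurable (graph_signal_space n)"
    and "n \<ge> 1 \<Longrightarrow> integrable (sample_law n (W, f)) (\<lambda>Gv. H (step_graphon_signal n Gv))"
    and "\<epsilon> > 0 \<Longrightarrow> \<exists>L. \<forall>\<^sub>F n in sequentially.
      (\<integral>Gv. \<bar>H (step_graphon_signal n Gv) - L\<bar> \<partial>sample_law n (W, f)) < \<epsilon>"
proof -
  let ?S = "\<lambda>n Gv. step_graphon_signal n (fst Gv, clip_signal r (snd Gv))"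
  let ?Z = "\<lambda>n Gv. H (step_graphon_signal n Gv)"
  let ?law = "\<lambda>n. sample_law n (W, f)"
  obtain P where P: "\<And>j. P j \<in> linear_span hom_densities"
    and lim: "uniform_limit (graphon_signals r) P H sequentially"
    using H unfolding uniform_closure_def by blast
  have S: "?S n Gv \<in> graphon_signals r" if "n \<ge> 1" for n Gv
    by (rule step_clip_signal_mem_graphon_signals[OF that r])
  have clip: "step_graphon_signal n Gv = ?S n Gv" if "\<forall>i<n. \<bar>snd Gv i\<bar> \<le> r" for n Gv
  proof -
    obtain G v where Gv: "Gv = (G, v)" by fastforce
    have "v i = clip_signal r v i" if "i < n" for i
      using \<open>\<forall>i<n. \<bar>snd Gv i\<bar> \<le> r\<close> that by (simp add: Gv clip_signal_eq)
    then show ?thesis by (simp add: Gv step_graphon_signal_def)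
  qed
  have Pmeas: "(\<lambda>Gv. P j (?S n Gv)) \<in> borel_measurable (graph_signal_space n)" if "n \<ge> 1" for j n
    using linear_span_hom_densities_sampling[OF Wf r P[of j]] that
    unfolding case_prod_unfold by blast
  have meas: "?Z n \<in> borel_measurable (graph_signal_space n)" if n: "n \<ge> 1" for n
  proof -
    have [measurable]: "(\<lambda>Gv. snd Gv i) \<in> borel_measurable (graph_signal_space n)" if "i < n" for i
      using that unfolding graph_signal_space_def
      by (intro measurable_compose[OF measurable_snd measurable_component_singleton]) auto
    have "Measurable.pred (graph_signal_space n) (\<lambda>Gv. \<forall>i\<in>{..<n}. \<bar>snd Gv i\<bar> \<le> r)"
      by (intro pred_intros_finite) auto
    then have pred: "Measurable.pred (graph_signal_space n) (\<lambda>Gv. \<forall>i<n. \<bar>snd Gv i\<bar> \<le> r)"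
      by simp
    have "(\<lambda>Gv. H (?S n Gv)) \<in> borel_measurable (graph_signal_space n)"
      by (rule borel_measurable_LIMSEQ_real[OF tendsto_uniform_limitI[OF lim S[OF n]] Pmeas[OF n]])
    then have "(\<lambda>Gv. if \<forall>i<n. \<bar>snd Gv i\<bar> \<le> r then H (?S n Gv) else a)
        \<in> borel_measurable (graph_signal_space n)"
      using pred by (intro measurable_If) auto
    \<comment> \<open>If all values are bounded by \<open>r\<close>, clipping does nothing;
      otherwise the step graphon-signal lies outside \<open>graphon_signals r\<close> and
      \<open>H\<close> equals \<open>a\<close>.\<close>
    moreover have "?Z n Gv = (if \<forall>i<n. \<bar>snd Gv i\<bar> \<le> r then H (?S n Gv) else a)" for Gv
      using clip[of n Gv] const
        step_graphon_signal_mem_iff[OF n r, of "fst Gv" "snd Gv"]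
      by auto
    ultimately show ?thesis by simp
  qed
  then show "n \<ge> 1 \<Longrightarrow> ?Z n \<in> borel_measurable (graph_signal_space n)" .
  have AE: "AE Gv in ?law n. ?Z n Gv = H (?S n Gv)" for n
    using AE_sample_law_abs_le[OF Wf, of n] by eventually_elim (simp add: clip)
  have approx: "\<exists>P\<in>linear_span hom_densities. \<forall>x\<in>graphon_signals r. \<bar>P x - H x\<bar> < e" if "e > 0" for e
  proof -
    have "\<forall>\<^sub>F j in sequentially. \<forall>x\<in>graphon_signals r. dist (P j x) (H x) < e"
      using uniform_limitD[OF lim that] .
    then obtain j where "\<forall>x\<in>graphon_signals r. dist (P j x) (H x) < e"
      using eventually_happens'[OF sequentially_bot] by blast
    then show ?thesis using P by (auto simp: dist_real_def)
  qed
  have int: "integrable (?law n) (?Z n)" if n: "n \<ge> 1" for n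
  proof -
    interpret law: prob_space "?law n" by (rule prob_space_sample_law(1)[OF Wf])
    \<comment> \<open>One approximant at distance 1 suffices for boundedness; it is the source of
      the bound \<open>B + 1\<close>.\<close>
    obtain P1 where P1: "P1 \<in> linear_span hom_densities" "\<And>x. x \<in> graphon_signals r \<Longrightarrow> \<bar>P1 x - H x\<bar> < 1"
      using approx[of 1] by auto
    obtain L B where B: "\<And>n G v. n \<ge> 1 \<Longrightarrow> \<bar>P1 (step_graphon_signal n (G, clip_signal r v))\<bar> \<le> B"
      using linear_span_hom_densities_sampling[OF Wf r P1(1)] by blast
    have bound: "\<bar>H (?S n Gv)\<bar> \<le> B + 1" for Gv
      using B[OF n, of "fst Gv" "snd Gv"] P1(2)[OF S[OF n, of Gv]] by linarith
    have "AE Gv in ?law n. norm (?Z n Gv) \<le> B + 1"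
      using AE[of n] by eventually_elim (simp add: bound)
    then show ?thesis
      using meas[OF n] prob_space_sample_law(2)[OF Wf, of n]
      by (intro law.integrable_const_bound) (auto cong: measurable_cong_sets)
  qed
  then show "n \<ge> 1 \<Longrightarrow> integrable (?law n) (?Z n)" .
  show "\<exists>L. \<forall>\<^sub>F n in sequentially. (\<integral>Gv. \<bar>?Z n Gv - L\<bar> \<partial>?law n) < \<epsilon>" if \<epsilon>: "\<epsilon> > 0"
  proof -
    obtain Q where Q: "Q \<in> linear_span hom_densities" "\<And>x. x \<in> graphon_signals r \<Longrightarrow> \<bar>Q x - H x\<bar> < \<epsilon> / 2"
      using approx[of "\<epsilon> / 2"] \<epsilon> by auto
    obtain L B where Qm: "\<And>n. n \<ge> 1 \<Longrightarrow> (\<lambda>(G, v). Q (step_graphon_signal n (G, clip_signal r v)))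
          \<in> borel_measurable (graph_signal_space n)"
      and QB: "\<And>n G v. n \<ge> 1 \<Longrightarrow> \<bar>Q (step_graphon_signal n (G, clip_signal r v))\<bar> \<le> B"
      and Qlim: "(\<lambda>n. \<integral>(G, v). \<bar>Q (step_graphon_signal n (G, clip_signal r v)) - L\<bar> \<partial>?law n)
          \<longlonglongrightarrow> 0"
      using linear_span_hom_densities_sampling[OF Wf r Q(1)] by blast
    have "\<forall>\<^sub>F n in sequentially. (\<integral>Gv. \<bar>Q (?S n Gv) - L\<bar> \<partial>?law n) < \<epsilon> / 2"
      using order_tendstoD(2)[OF Qlim, of "\<epsilon> / 2"] \<epsilon> by (simp add: case_prod_unfold)
    then have "\<forall>\<^sub>F n in sequentially. (\<integral>Gv. \<bar>?Z n Gv - L\<bar> \<partial>?law n) < \<epsilon>"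
      using eventually_ge_at_top[of 1]
    proof eventually_elim
      case (elim n)
      then have n: "n \<ge> 1" by simp
      interpret law: prob_space "?law n" by (rule prob_space_sample_law(1)[OF Wf])
      have Qi: "integrable (?law n) (\<lambda>Gv. Q (?S n Gv))"
        using integral_sample_law(1)[OF Wf Qm[OF n], of B] QB[OF n] by (auto simp: case_prod_unfold)
      have "(\<integral>Gv. \<bar>?Z n Gv - L\<bar> \<partial>?law n) \<le> (\<integral>Gv. \<epsilon> / 2 + \<bar>Q (?S n Gv) - L\<bar> \<partial>?law n)"
      proof (rule integral_mono_AE)
        show "AE Gv in ?law n. \<bar>?Z n Gv - L\<bar> \<le> \<epsilon> / 2 + \<bar>Q (?S n Gv) - L\<bar>"
          using AE[of n]
        proof eventually_elim
          case (elim Gv)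
          show ?case using Q(2)[OF S[OF n, of Gv]] unfolding elim by linarith
        qed
      qed (use int[OF n] Qi in auto)
      also have "\<dots> = \<epsilon> / 2 + (\<integral>Gv. \<bar>Q (?S n Gv) - L\<bar> \<partial>?law n)"
        using Qi by (simp add: law.prob_space)
      also have "\<dots> < \<epsilon>" using elim by simp
      finally show ?case .
    qed
    then show ?thesis ..
  qed
qed

text \<open>A separate space \<open>M n m\<close> for each pair of sizes allows arbitrary couplings,
  a single common space included. Integrability is part of the conclusion because the Bochner
  integral of a nonintegrable function is 0 by convention, which would make the limit say
  nothing.\<close>

theorem theorem5p2:
  fixes r :: real
    and \<N> :: "graphon_signal set \<Rightarrow> real"
    and W :: "real \<times> real \<Rightarrow> real" and f :: "real \<Rightarrow> real"
    and M :: "nat \<Rightarrow> nat \<Rightarrow> 'w measure"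
    and X Y :: "nat \<Rightarrow> nat \<Rightarrow> 'w \<Rightarrow> graph_signal"
  assumes "r > 1"
    and "(\<lambda>x. \<N> (gs_class r x)) \<in> uniform_closure (graphon_signals r) (linear_span hom_densities)"
    and "(W, f) \<in> graphon_signals r"
    and "\<And>n m. n \<ge> 1 \<Longrightarrow> m \<ge> 1 \<Longrightarrow> prob_space (M n m)"
    and "\<And>n m. n \<ge> 1 \<Longrightarrow> m \<ge> 1 \<Longrightarrow> X n m \<in> measurable (M n m) (graph_signal_space n)"
    and "\<And>n m. n \<ge> 1 \<Longrightarrow> m \<ge> 1 \<Longrightarrow>
           distr (M n m) (graph_signal_space n) (X n m) = sample_law n (W, f)"
    and "\<And>n m. n \<ge> 1 \<Longrightarrow> m \<ge> 1 \<Longrightarrow> Y n m \<in> measurable (M n m) (graph_signal_space m)"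
    and "\<And>n m. n \<ge> 1 \<Longrightarrow> m \<ge> 1 \<Longrightarrow>
           distr (M n m) (graph_signal_space m) (Y n m) = sample_law m (W, f)"
  defines "D \<equiv> \<lambda>n m \<omega>. \<bar>\<N> (gs_class r (step_graphon_signal n (X n m \<omega>))) -
                          \<N> (gs_class r (step_graphon_signal m (Y n m \<omega>)))\<bar>"
  shows "(\<forall>n\<ge>1. \<forall>m\<ge>1. integrable (M n m) (D n m)) \<and>
         ((\<lambda>(n, m). \<integral>\<omega>. D n m \<omega> \<partial>M n m) \<longlongrightarrow> 0) (sequentially \<times>\<^sub>F sequentially)"
proof -
  let ?Z = "\<lambda>n Gv. \<N> (gs_class r (step_graphon_signal n Gv))"
  let ?law = "\<lambda>n. sample_law n (W, f)"
  have r: "0 \<le> r" using assms(1) by simp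
  \<comment> \<open>\<open>cut_equiv r\<close> relates only members of
    \<open>graphon_signals r\<close>, so every other point has the empty class. This supplies the
    constant value required above.\<close>
  have off: "\<forall>x\<in>- graphon_signals r. \<N> (gs_class r x) = \<N> {}"
  proof
    fix x assume "x \<in> - graphon_signals r"
    then have "gs_class r x = {}" by (auto simp: gs_class_def cut_equiv_def)
    then show "\<N> (gs_class r x) = \<N> {}" by simp
  qed
  note Z = uniform_closure_hom_densities_sampling[OF assms(3) r assms(2) off]
  have X: "integrable (M n m) (\<lambda>\<omega>. \<bar>?Z n (X n m \<omega>) - c\<bar>)"
      "(\<integral>\<omega>. \<bar>?Z n (X n m \<omega>) - c\<bar> \<partial>M n m) = (\<integral>Gv. \<bar>?Z n Gv - c\<bar> \<partial>?law n)"
    and Y: "integrable (M n m) (\<lambda>\<omega>. \<bar>?Z m (Y n m \<omega>) - c\<bar>)"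
      "(\<integral>\<omega>. \<bar>?Z m (Y n m \<omega>) - c\<bar> \<partial>M n m) = (\<integral>Gv. \<bar>?Z m Gv - c\<bar> \<partial>?law m)"
    if nm: "n \<ge> 1" "m \<ge> 1" for n m c
  proof -
    have Zi: "integrable (?law k) (\<lambda>Gv. \<bar>?Z k Gv - c\<bar>)"
      "(\<lambda>Gv. \<bar>?Z k Gv - c\<bar>) \<in> borel_measurable (graph_signal_space k)" if "k \<ge> 1" for k
    proof -
      interpret law: prob_space "?law k" by (rule prob_space_sample_law(1)[OF assms(3)])
      show "integrable (?law k) (\<lambda>Gv. \<bar>?Z k Gv - c\<bar>)" using Z(2)[OF that] by simp
      note Z(1)[OF that, measurable]
      show "(\<lambda>Gv. \<bar>?Z k Gv - c\<bar>) \<in> borel_measurable (graph_signal_space k)" by measurable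
    qed
    show "integrable (M n m) (\<lambda>\<omega>. \<bar>?Z n (X n m \<omega>) - c\<bar>)"
      using integrable_distr_eq[OF assms(5)[OF nm] Zi(2)[OF nm(1)]] Zi(1)[OF nm(1)]
      by (simp add: assms(6)[OF nm])
    show "(\<integral>\<omega>. \<bar>?Z n (X n m \<omega>) - c\<bar> \<partial>M n m) = (\<integral>Gv. \<bar>?Z n Gv - c\<bar> \<partial>?law n)"
      using integral_distr[OF assms(5)[OF nm] Zi(2)[OF nm(1)]] by (simp add: assms(6)[OF nm])
    show "integrable (M n m) (\<lambda>\<omega>. \<bar>?Z m (Y n m \<omega>) - c\<bar>)"
      using integrable_distr_eq[OF assms(7)[OF nm] Zi(2)[OF nm(2)]] Zi(1)[OF nm(2)]
      by (simp add: assms(8)[OF nm])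
    show "(\<integral>\<omega>. \<bar>?Z m (Y n m \<omega>) - c\<bar> \<partial>M n m) = (\<integral>Gv. \<bar>?Z m Gv - c\<bar> \<partial>?law m)"
      using integral_distr[OF assms(7)[OF nm] Zi(2)[OF nm(2)]] by (simp add: assms(8)[OF nm])
  qed
  \<comment> \<open>Inserting a constant \<open>c\<close> separates the two samples, so that only
    their marginal laws matter.\<close>
  have D_le: "D n m \<omega> \<le> \<bar>?Z n (X n m \<omega>) - c\<bar> + \<bar>?Z m (Y n m \<omega>) - c\<bar>" for n m \<omega> c
    unfolding D_def by linarith
  have D_nonneg: "0 \<le> D n m \<omega>" for n m \<omega> by (simp add: D_def)
  have D_int: "integrable (M n m) (D n m)" if nm: "n \<ge> 1" "m \<ge> 1" for n m
  proof (rule Bochner_Integration.integrable_bound)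
    show "integrable (M n m) (\<lambda>\<omega>. \<bar>?Z n (X n m \<omega>) - 0\<bar> + \<bar>?Z m (Y n m \<omega>) - 0\<bar>)"
      using X(1)[OF nm] Y(1)[OF nm] by (intro Bochner_Integration.integrable_add)
    note measurable_compose[OF assms(5)[OF nm] Z(1)[OF nm(1)], measurable]
      measurable_compose[OF assms(7)[OF nm] Z(1)[OF nm(2)], measurable]
    show "D n m \<in> borel_measurable (M n m)" unfolding D_def by measurable
    show "AE \<omega> in M n m. norm (D n m \<omega>) \<le> norm (\<bar>?Z n (X n m \<omega>) - 0\<bar> + \<bar>?Z m (Y n m \<omega>) - 0\<bar>)"
      using D_le[of n m _ 0] D_nonneg by auto
  qed
  have "((\<lambda>p. \<integral>\<omega>. D (fst p) (snd p) \<omega> \<partial>M (fst p) (snd p)) \<longlongrightarrow> 0)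
      (sequentially \<times>\<^sub>F sequentially)"
  proof (rule tendstoI)
    fix e :: real assume "e > 0"
    \<comment> \<open>The same \<open>c\<close> serves both samples, since each sample size has the
      same limiting constant up to \<open>e / 2\<close>.\<close>
    then obtain c where c: "\<forall>\<^sub>F n in sequentially. (\<integral>Gv. \<bar>?Z n Gv - c\<bar> \<partial>?law n) < e / 2"
      using Z(3)[of "e / 2"] by auto
    have ev: "\<forall>\<^sub>F n in sequentially. n \<ge> 1 \<and> (\<integral>Gv. \<bar>?Z n Gv - c\<bar> \<partial>?law n) < e / 2"
      by (intro eventually_conj eventually_ge_at_top c)
    have "dist (\<integral>\<omega>. D n m \<omega> \<partial>M n m) 0 < e"
      if "n \<ge> 1 \<and> (\<integral>Gv. \<bar>?Z n Gv - c\<bar> \<partial>?law n) < e / 2"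
        "m \<ge> 1 \<and> (\<integral>Gv. \<bar>?Z m Gv - c\<bar> \<partial>?law m) < e / 2" for n m
    proof -
      have nm: "n \<ge> 1" "m \<ge> 1" using that by auto
      have "(\<integral>\<omega>. D n m \<omega> \<partial>M n m) \<le>
          (\<integral>\<omega>. \<bar>?Z n (X n m \<omega>) - c\<bar> + \<bar>?Z m (Y n m \<omega>) - c\<bar> \<partial>M n m)"
        using D_int[OF nm] X(1)[OF nm] Y(1)[OF nm] D_le
        by (intro integral_mono Bochner_Integration.integrable_add) auto
      also have "\<dots> = (\<integral>Gv. \<bar>?Z n Gv - c\<bar> \<partial>?law n) + (\<integral>Gv. \<bar>?Z m Gv - c\<bar> \<partial>?law m)"
        using X[OF nm] Y[OF nm] by (simp only: Bochner_Integration.integral_add)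
      also have "\<dots> < e" using that by simp
      finally show ?thesis
        using D_nonneg by (simp add: dist_real_def Bochner_Integration.integral_nonneg)
    qed
    then show "\<forall>\<^sub>F p in sequentially \<times>\<^sub>F sequentially.
        dist (\<integral>\<omega>. D (fst p) (snd p) \<omega> \<partial>M (fst p) (snd p)) 0 < e"
      unfolding eventually_prod_filter using ev by fastforce
  qed
  then show ?thesis using D_int by (simp add: case_prod_unfold)
qed

end
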